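(* Let $0\le q\le 1\le r<\infty$, $q<r$, and let $\{Z_t\}_{t\ge 0}$ be a $(q,r)$-extendable branching process with offspring generating function $f$. Then for every $t>0$ the (possibly defective) probability generating function $F_t(s)=\mathrm{E}(s^{Z_t})$ is $(q,r)$-extendable. If $f'(r)<\infty$, then $$F_t'(q)=e^{-\alpha t},\quad \alpha=1-f'(q),\qquad F_t'(r)=e^{\beta t},\quad \beta=f'(r)-1,$$ $\gamma=\alpha/\beta\in(0,1]$, and for $s\in[0,q)\cup(q,r)$, $$\frac{F_t(s)-q}{s-q}=e^{-\alpha t}\Big\{\frac{r-F_t(s)}{r-s}\Big\}^{\gamma}\exp\Big\{\int_s^{F_t(s)}\psi_{q,r}(x)\,dx\Big\},$$ where $$\psi_{q,r}(x)=\frac{f^{(4)}(q,q,r,x)-\gamma f^{(4)}(q,r,r,x)}{f^{(3)}(q,r,x)}.$$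
   Context: Branching process: $f(s)=\sum_{k\ge0}p_ks^k$ with $p_k\ge0$, $f(1)\le1$, $p_1\ne1$. $\{Z_t\}_{t\ge0}$ is the continuous-time Markov branching process with $Z_0=1$: particles have independent exponential life lengths with parameter 1; at death a particle is, independently of everything else, replaced by $k$ particles with probability $p_k$, $k\ge0$, while with probability $1-f(1)$ it sends the whole process to an absorbing graveyard state $\Delta$. With the convention $s^\Delta=0$, $F_t(s)=\mathrm{E}(s^{Z_t})=\sum_{k\ge0}\mathrm{P}(Z_t=k)s^k$. A possibly defective probability generating function $f$ (a power series with nonnegative coefficients and $f(1)\le1$) is $(q,r)$-extendable, where $0\le q\le1\le r<\infty$, $q<r$, if $f(q)=q$ and $f(r)=r$. The branching process is $(q,r)$-extendable if its offspring generating function is. Tail generating functions: for $v(s)=\sum_{k\ge0}v_ks^k$ with all $v_k\ge0$ and $n\ge1$, $$v^{(n)}(s_1,\ldots,s_n)=\sum_{i_1\ge0,\ldots,i_n\ge0}v_{i_1+\cdots+i_n+n-1}\,s_1^{i_1}\cdots s_n^{i_n}.$$ (Here $v^{(n)}$ with $n$ arguments denotes the tail generating function, not a derivative.)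
   Formalization: F_t is shown (q,r)-extendable only if f'(r)<∞ or the integral of 1/(x-f(x)) up to r diverges (necessary too); otherwise F_t(r)<r, e.g. f(s)=2(1-√(1-s/2)), q=0, r=2. That F_t is a defective p.g.f. with F_t(q)=q is unconditional. *)

theory Defs
  imports "HOL-Probability.Probability"
begin

definition gf :: "(nat \<Rightarrow> real) \<Rightarrow> real \<Rightarrow> real" where
  "gf v s = (\<Sum>k. v k * s ^ k)"

definition defective_pgf :: "(nat \<Rightarrow> real) \<Rightarrow> bool" where
  "defective_pgf v \<longleftrightarrow> (\<forall>k. 0 \<le> v k) \<and> summable v \<and> suminf v \<le> 1"

text \<open>Convergence of the two series is part of the condition, hence \<open>sums\<close>.\<close>
definition extendable :: "real \<Rightarrow> real \<Rightarrow> (nat \<Rightarrow> real) \<Rightarrow> bool" where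
  "extendable q r v \<longleftrightarrow> defective_pgf v \<and> 0 \<le> q \<and> q \<le> 1 \<and> 1 \<le> r \<and> q < r \<and>
     (\<lambda>k. v k * q ^ k) sums q \<and> (\<lambda>k. v k * r ^ k) sums r"

text \<open>The arguments form a nonempty list, whose length is the order of the tail
  generating function; the sum runs over all multi-indices of that length.\<close>
definition tail_gf :: "(nat \<Rightarrow> real) \<Rightarrow> real list \<Rightarrow> real" where
  "tail_gf v ss = (\<Sum>\<^sub>\<infinity>is | length is = length ss.
     v (sum_list is + length ss - 1) * (\<Prod>j<length ss. (ss ! j) ^ (is ! j)))"

definition psi :: "(nat \<Rightarrow> real) \<Rightarrow> real \<Rightarrow> real \<Rightarrow> real \<Rightarrow> real \<Rightarrow> real" where
  "psi v q r \<gamma> x =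
     (tail_gf v [q, q, r, x] - \<gamma> * tail_gf v [q, r, r, x]) / tail_gf v [q, r, x]"

text \<open>Particles are labelled as in the Ulam--Harris tree: the root is \<open>[]\<close> and \<open>u @ [i]\<close> is
  child number \<open>i\<close> of \<open>u\<close>. Each label \<open>u\<close> carries a life length \<open>l u\<close> and an offspring
  number \<open>n u\<close>, where \<open>None\<close> means that the death of \<open>u\<close> sends the whole process to the
  graveyard. The next definitions are for one fixed realization \<open>l\<close>, \<open>n\<close>.\<close>

definition in_tree :: "(nat list \<Rightarrow> nat option) \<Rightarrow> nat list \<Rightarrow> bool" where
  "in_tree n u \<longleftrightarrow> (\<forall>j<length u. \<exists>k. n (take j u) = Some k \<and> u ! j < k)"

definition birth_time :: "(nat list \<Rightarrow> real) \<Rightarrow> nat list \<Rightarrow> real" where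
  "birth_time l u = (\<Sum>j<length u. l (take j u))"

definition born :: "(nat list \<Rightarrow> real) \<Rightarrow> (nat list \<Rightarrow> nat option) \<Rightarrow> real \<Rightarrow> nat list set" where
  "born l n t = {u. in_tree n u \<and> birth_time l u \<le> t}"

definition alive :: "(nat list \<Rightarrow> real) \<Rightarrow> (nat list \<Rightarrow> nat option) \<Rightarrow> real \<Rightarrow> nat list set" where
  "alive l n t = {u \<in> born l n t. t < birth_time l u + l u}"

definition terminated :: "(nat list \<Rightarrow> real) \<Rightarrow> (nat list \<Rightarrow> nat option) \<Rightarrow> real \<Rightarrow> bool" where
  "terminated l n t \<longleftrightarrow> (\<exists>u \<in> born l n t. birth_time l u + l u \<le> t \<and> n u = None)"

text \<open>\<open>None\<close> is the graveyard. If infinitely many particles have been born by time \<open>t\<close>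
  (explosion), there is no population size in \<open>nat\<close>, and the state is also \<open>None\<close>, in
  accordance with \<open>s\<^sup>\<infinity> = 0\<close> for \<open>0 \<le> s < 1\<close>.\<close>
definition Z :: "(nat list \<Rightarrow> real) \<Rightarrow> (nat list \<Rightarrow> nat option) \<Rightarrow> real \<Rightarrow> nat option" where
  "Z l n t = (if terminated l n t \<or> infinite (born l n t) then None
              else Some (card (alive l n t)))"

text \<open>Independence of the pairs over all labels, together with independence within each pair,
  is the joint independence of all life lengths and offspring numbers.\<close>
locale branching_process = prob_space M for M :: "'w measure" +
  fixes p :: "nat \<Rightarrow> real"
    and L :: "nat list \<Rightarrow> 'w \<Rightarrow> real"
    and N :: "nat list \<Rightarrow> 'w \<Rightarrow> nat option"
  assumes offspring_pgf: "defective_pgf p"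
    and p1: "p 1 \<noteq> 1"
    and life_length: "\<And>u. distributed M lborel (L u) (exponential_density 1)"
    and offspring_Some: "\<And>u k. prob {\<omega> \<in> space M. N u \<omega> = Some k} = p k"
    and offspring_None: "\<And>u. prob {\<omega> \<in> space M. N u \<omega> = None} = 1 - gf p 1"
    and indep_pairs: "indep_vars (\<lambda>_. borel \<Otimes>\<^sub>M count_space UNIV)
                        (\<lambda>u \<omega>. (L u \<omega>, N u \<omega>)) UNIV"
    and indep_within: "\<And>u. indep_set {L u -` A \<inter> space M | A. A \<in> sets borel}
                                          {N u -` B \<inter> space M | B. B \<in> sets (count_space UNIV)}"

definition state_prob ::
    "'w measure \<Rightarrow> (nat list \<Rightarrow> 'w \<Rightarrow> real) \<Rightarrow> (nat list \<Rightarrow> 'w \<Rightarrow> nat option) \<Rightarrow>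
     real \<Rightarrow> nat \<Rightarrow> real" where
  "state_prob M L N t k =
     measure M {\<omega> \<in> space M. Z (\<lambda>u. L u \<omega>) (\<lambda>u. N u \<omega>) t = Some k}"

text \<open>Osgood's condition at \<open>r\<close>: the solution of \<open>dF/dt = f(F) - F\<close> started at the fixed
  point \<open>r\<close> cannot leave it. It holds whenever the left derivative of \<open>f\<close> at \<open>r\<close> is finite;
  for \<open>r = 1\<close> it is the classical criterion for non-explosion. It is not automatic:
  \<open>f(s) = 2 (1 - sqrt (1 - s/2))\<close> is \<open>(0,2)\<close>-extendable, but \<open>F\<^sub>t(2) < 2\<close> for all \<open>t > 0\<close>.\<close>
definition osgood :: "real \<Rightarrow> real \<Rightarrow> (nat \<Rightarrow> real) \<Rightarrow> bool" where
  "osgood q r v \<longleftrightarrow>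
     (\<forall>m. q < m \<and> m < r \<longrightarrow>
        (\<integral>\<^sup>+x\<in>{m..<r}. ennreal (1 / (x - gf v x)) \<partial>lborel) = \<infinity>)"

end

theory Submission
  imports Defs "HOL-Computational_Algebra.Formal_Power_Series"
begin

text \<open>Conditioning on the life length and the offspring number of the root, and truncating the
  tree at generation \<open>m\<close> so that one can induct on \<open>m\<close>, one finds that \<open>G(t) = F\<^sub>t(s)\<close> solves
  \<open>G(t) = e\<^sup>-\<^sup>t (s + \<integral>\<^sub>0\<^sup>t e\<^sup>u f(G(u)) du)\<close>, hence \<open>G' = f(G) - G\<close> and \<open>G(0) = s\<close>. The truncation
  is monotone and nonnegative, so this holds in \<open>[0, \<infinity>]\<close> for every \<open>s \<ge> 0\<close>, and a fixed point of \<open>f\<close>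
  above \<open>s\<close> bounds every truncation: this gives convergence up to \<open>s = r\<close> even when \<open>r > 1\<close>.

  The functions \<open>f\<^sup>(\<^sup>n\<^sup>)\<close> are divided differences of \<open>f\<close>, so
  \<open>f(x) - x = (x - q) (x - r) f\<^sup>(\<^sup>3\<^sup>)(q, r, x)\<close> and \<open>\<psi>\<close> satisfies
  \<open>\<psi>(x) (f(x) - x) = (f(x) - x) / (x - q) - \<gamma> (f(x) - x) / (x - r) + \<alpha>\<close>. Along a trajectory of the
  differential equation this is the derivative of \<open>ln |G - q| - \<gamma> ln (r - G) + \<alpha> t\<close>, and the formula
  follows by substituting \<open>x = G(u)\<close>. The derivatives at \<open>q\<close> and \<open>r\<close> come from the linearization
  of the differential equation at these two equilibria.\<close>

text \<open>The delicate point is \<open>r\<close>. A fixed point of f above \<open>s\<close> bounds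
  \<open>F t s\<close> only from above. At \<open>q\<close> this suffices, because f(x) - x is
  nonnegative on [0, q] and keeps the trajectory from decreasing. On [q, r] the drift f(x) - x is
  nonpositive, so at \<open>r\<close> the bound and the drift point the same way and nothing
  prevents \<open>F t r < r\<close>: f need not be Lipschitz there, and uniqueness for the
  differential equation cannot be invoked. Either Osgood's condition or a finite left derivative has
  to hold the trajectory at \<open>r\<close>. All other facts about the flow come from monotonicity
  and Gronwall estimates rather than from a uniqueness theorem.

  The quantitative input is the function \<open>K\<close>, that is f^(3)(q, r, x). Its series has
  nonnegative terms, increasing in x. It is positive because f is not affine, which fixes the sign
  of the drift on either side of \<open>q\<close>; when f'(r) is finite it is bounded by its value
  at \<open>r\<close>, which yields the linear bounds on the drift. Its values at \<open>q\<close>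
  and \<open>r\<close> are alpha and beta divided by r - q, hence the bounds on gamma.\<close>

lemma gf_summable:
  fixes x r :: real
  assumes "\<And>k. 0 \<le> v k" "summable (\<lambda>k. v k * r ^ k)" "0 \<le> x" "x \<le> r"
  shows "summable (\<lambda>k. v k * x ^ k)"
proof (rule summable_comparison_test'[OF assms(2)])
  fix k show "norm (v k * x ^ k) \<le> v k * r ^ k"
    using assms by (simp add: abs_mult mult_left_mono power_mono)
qed

lemma gf_mono:
  assumes "\<And>k. 0 \<le> v k" "summable (\<lambda>k. v k * y ^ k)" "0 \<le> x" "x \<le> y"
  shows "gf v x \<le> gf v y"
  unfolding gf_def
  using assms by (intro suminf_le gf_summable[of v y x] mult_left_mono power_mono) simp_all

lemma gf_nonneg:
  assumes "\<And>k. 0 \<le> v k" "summable (\<lambda>k. v k * x ^ k)" "0 \<le> x"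
  shows "0 \<le> gf v x"
  unfolding gf_def using assms by (intro suminf_nonneg) simp_all

lemma continuous_on_gf:
  assumes "\<And>k. 0 \<le> v k" "summable (\<lambda>k. v k * r ^ k)"
  shows "continuous_on {0..r} (gf v)"
proof -
  have "uniform_limit {0..r} (\<lambda>n x. \<Sum>k<n. v k * x ^ k) (\<lambda>x. \<Sum>k. v k * x ^ k) sequentially"
    by (rule Weierstrass_m_test[OF _ assms(2)]) (simp add: assms(1) abs_mult mult_left_mono power_mono)
  moreover have "continuous_on {0..r} (\<lambda>x. \<Sum>k<n. v k * x ^ k)" for n
    by (intro continuous_intros)
  then have "\<forall>\<^sub>F n in sequentially. continuous_on {0..r} (\<lambda>x. \<Sum>k<n. v k * x ^ k)"
    by simp
  ultimately show ?thesis
    unfolding gf_def[abs_def] by (intro uniform_limit_theorem[where F=sequentially]) simp_all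
qed

section \<open>Tail generating functions as divided differences\<close>

text \<open>The complete homogeneous symmetric polynomial of degree \<open>m\<close> in the entries
  of \<open>ss\<close>. Written as a coefficient of a product of geometric series, it is visibly
  symmetric, and its recursion is the Cauchy product.\<close>

definition complete_hom :: "real list \<Rightarrow> nat \<Rightarrow> real" where
  "complete_hom ss m = fps_nth (prod_list (map (\<lambda>a. Abs_fps (\<lambda>i. a ^ i)) ss)) m"

lemma complete_hom_Cons:
  "complete_hom (a # ss) m = (\<Sum>i=0..m. a ^ i * complete_hom ss (m - i))"
  by (simp add: complete_hom_def fps_mult_nth)

lemma complete_hom_Nil: "complete_hom [] m = (if m = 0 then 1 else 0)"
  by (simp add: complete_hom_def)

lemma complete_hom_single: "complete_hom [a] m = a ^ m"
  by (simp add: complete_hom_def)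

lemma complete_hom_0 [simp]: "complete_hom ss 0 = 1"
  by (induction ss) (simp_all add: complete_hom_Nil complete_hom_Cons)

lemma complete_hom_perm: "mset xs = mset ys \<Longrightarrow> complete_hom xs = complete_hom ys"
  unfolding complete_hom_def[abs_def] prod_mset_prod_list[symmetric] mset_map by simp

lemma complete_hom_nonneg: "\<forall>a\<in>set ss. 0 \<le> a \<Longrightarrow> 0 \<le> complete_hom ss m"
  by (induction ss arbitrary: m) (simp_all add: complete_hom_Nil complete_hom_Cons sum_nonneg)

lemma complete_hom_mono:
  assumes "list_all2 (\<lambda>a b. 0 \<le> a \<and> a \<le> b) xs ys"
  shows "complete_hom xs m \<le> complete_hom ys m"
  using assms
proof (induction arbitrary: m)
  case (Cons a xs b ys)
  have "\<forall>y\<in>set xs. 0 \<le> y"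
    using Cons.hyps(2) by (induction rule: list_all2_induct) simp_all
  with Cons show ?case
    unfolding complete_hom_Cons by (intro sum_mono mult_mono power_mono complete_hom_nonneg) simp_all
qed simp

lemma complete_hom_Cons_ge:
  assumes "0 \<le> a" "\<forall>a\<in>set ss. 0 \<le> a"
  shows "complete_hom ss m \<le> complete_hom (a # ss) m"
proof -
  have "complete_hom ss m = (\<Sum>i\<in>{0}. a ^ i * complete_hom ss (m - i))" by simp
  also have "\<dots> \<le> complete_hom (a # ss) m"
    unfolding complete_hom_Cons using assms
    by (intro sum_mono2) (simp_all add: complete_hom_nonneg)
  finally show ?thesis .
qed

lemma complete_hom_double: "complete_hom [a, a] m = real (Suc m) * a ^ m"
proof -
  have "complete_hom [a, a] m = (\<Sum>i=0..m. a ^ m)"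
    unfolding complete_hom_Cons[of a "[a]"] complete_hom_single
    by (intro sum.cong refl) (simp add: power_add[symmetric])
  then show ?thesis by simp
qed

text \<open>The generating functions \<open>A = 1 / (1 - a X)\<close> and \<open>B = 1 / (1 - b X)\<close> satisfy
  \<open>A - B = (a - b) X A B\<close>.\<close>
lemma complete_hom_diff:
  "(a - b) * complete_hom (a # b # ss) m = complete_hom (a # ss) (Suc m) - complete_hom (b # ss) (Suc m)"
proof -
  define A B P where "A = Abs_fps (\<lambda>i. a ^ i)" and "B = Abs_fps (\<lambda>i. b ^ i)"
    and "P = prod_list (map (\<lambda>a. Abs_fps (\<lambda>i. a ^ i)) ss)"
  have geom: "(1 - fps_const c * fps_X) * Abs_fps (\<lambda>i. c ^ i) = 1" for c :: real
    by (rule fps_ext) (auto simp: left_diff_distrib mult.assoc power_Suc[symmetric] simp del: power_Suc)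
  have A: "(1 - fps_const a * fps_X) * A = 1" and B: "(1 - fps_const b * fps_X) * B = 1"
    unfolding A_def B_def by (rule geom)+
  have "A - B = A * ((1 - fps_const b * fps_X) * B) - B * ((1 - fps_const a * fps_X) * A)"
    by (simp only: A B mult_1_right)
  also have "\<dots> = (fps_const a - fps_const b) * (fps_X * (A * B))"
    by (simp only: algebra_simps)
  finally have "A * P - B * P = fps_const (a - b) * (fps_X * (A * (B * P)))"
    by (simp only: left_diff_distrib[symmetric] fps_const_sub mult.assoc)
  then have "fps_nth (A * P - B * P) (Suc m) = (a - b) * fps_nth (A * (B * P)) m"
    by simp
  then show ?thesis by (simp add: complete_hom_def A_def B_def P_def)
qed

definition multi_indices :: "nat \<Rightarrow> nat \<Rightarrow> nat list set" where
  "multi_indices n m = {is. length is = n \<and> sum_list is = m}"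

lemma multi_indices_Suc: "multi_indices (Suc n) m = (\<lambda>(i, is). i # is) ` (SIGMA i:{0..m}. multi_indices n (m - i))"
proof (intro set_eqI iffI)
  fix xs assume "xs \<in> multi_indices (Suc n) m"
  then obtain i "is" where "xs = i # is" "length is = n" "i + sum_list is = m"
    unfolding multi_indices_def by (cases xs) auto
  then show "xs \<in> (\<lambda>(i, is). i # is) ` (SIGMA i:{0..m}. multi_indices n (m - i))"
    by (intro image_eqI[of _ _ "(i, is)"]) (auto simp: multi_indices_def)
qed (auto simp: multi_indices_def)

lemma finite_multi_indices: "finite (multi_indices n m)"
proof (induction n arbitrary: m)
  case 0
  have "multi_indices 0 m \<subseteq> {[]}" by (auto simp: multi_indices_def)
  then show ?case by (rule finite_subset) simp
next
  case (Suc n)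
  then show ?case unfolding multi_indices_Suc by (intro finite_imageI finite_SigmaI) simp_all
qed

lemma sum_multi_indices:
  "(\<Sum>is\<in>multi_indices (length ss) m. \<Prod>j<length ss. (ss ! j) ^ (is ! j)) = complete_hom ss m"
proof (induction ss arbitrary: m)
  case Nil
  have "multi_indices 0 m = (if m = 0 then {[]} else {})"
    by (auto simp: multi_indices_def)
  then show ?case by (simp add: complete_hom_Nil)
next
  case (Cons a ss)
  have inj: "inj_on (\<lambda>(i, is). i # is) S" for S :: "(nat \<times> nat list) set"
    by (auto simp: inj_on_def)
  have "(\<Sum>is\<in>multi_indices (length (a # ss)) m. \<Prod>j<length (a # ss). ((a # ss) ! j) ^ (is ! j)) =
      (\<Sum>(i, is)\<in>(SIGMA i:{0..m}. multi_indices (length ss) (m - i)). a ^ i * (\<Prod>j<length ss. (ss ! j) ^ (is ! j)))"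
    unfolding length_Cons multi_indices_Suc
    by (subst sum.reindex[OF inj]) (simp add: prod.lessThan_Suc_shift case_prod_unfold del: prod.lessThan_Suc)
  also have "\<dots> = (\<Sum>i=0..m. \<Sum>is\<in>multi_indices (length ss) (m - i). a ^ i * (\<Prod>j<length ss. (ss ! j) ^ (is ! j)))"
    by (rule sum.Sigma[symmetric]) (simp_all add: finite_multi_indices)
  also have "\<dots> = complete_hom (a # ss) m"
    by (simp only: complete_hom_Cons Cons.IH sum_distrib_left[symmetric])
  finally show ?case .
qed

text \<open>Group the multi-indices by their total degree \<open>m\<close>: each group is finite and
  contributes one coefficient of \<open>v\<close> times a complete homogeneous polynomial.
  Nonnegativity justifies the regrouping of the infinite sum.\<close>

lemma tail_gf_eqI:
  assumes v: "\<And>k. 0 \<le> v k" and ss: "\<forall>a\<in>set ss. 0 \<le> a"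
    and sums: "(\<lambda>m. v (m + length ss - 1) * complete_hom ss m) sums S"
  shows "tail_gf v ss = S"
proof -
  define g where "g = (\<lambda>is. v (sum_list is + length ss - 1) * (\<Prod>j<length ss. (ss ! j) ^ (is ! j)))"
  let ?I = "multi_indices (length ss)"
  have g_nonneg: "0 \<le> g is" for "is"
    using ss unfolding g_def by (intro mult_nonneg_nonneg v prod_nonneg) simp
  have inner: "infsum g (?I m) = v (m + length ss - 1) * complete_hom ss m" for m
  proof -
    have "infsum g (?I m) = (\<Sum>is\<in>?I m. g is)"
      by (rule infsum_finite[OF finite_multi_indices])
    also have "\<dots> = (\<Sum>is\<in>?I m. v (m + length ss - 1) * (\<Prod>j<length ss. (ss ! j) ^ (is ! j)))"
      by (rule sum.cong) (simp_all add: g_def multi_indices_def)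
    finally show ?thesis by (simp only: sum_distrib_left[symmetric] sum_multi_indices)
  qed
  have outer: "((\<lambda>m. infsum g (?I m)) has_sum S) UNIV"
    unfolding inner using sums
    by (rule sums_nonneg_imp_has_sum) (simp add: v complete_hom_nonneg[OF ss])
  have "(\<lambda>z. norm ((\<lambda>(m, is). g is) z)) summable_on Sigma UNIV ?I"
    unfolding Infinite_Sum.abs_summable_on_Sigma_iff
  proof (intro conjI ballI)
    fix m show "(\<lambda>is. norm ((\<lambda>(m, is). g is) (m, is))) summable_on ?I m"
      by (rule summable_on_finite[OF finite_multi_indices])
  next
    have "(\<lambda>m. norm (infsum g (?I m))) summable_on UNIV"
      using outer by (intro summable_on_iff_abs_summable_on_real[THEN iffD1]) (rule has_sum_imp_summable)
    then show "(\<lambda>m. norm (\<Sum>\<^sub>\<infinity>is\<in>?I m. norm ((\<lambda>(m, is). g is) (m, is)))) summable_on UNIV"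
      by (simp add: g_nonneg)
  qed
  then have "(\<lambda>(m, is). g is) summable_on Sigma UNIV ?I"
    by (rule abs_summable_summable)
  from infsum_Sigma'_banach[OF this] have "infsum (\<lambda>(m, is). g is) (Sigma UNIV ?I) = S"
    using infsumI[OF outer] by simp
  moreover have "bij_betw snd (Sigma UNIV ?I) {is. length is = length ss}"
    by (rule bij_betw_byWitness[where f'="\<lambda>is. (sum_list is, is)"]) (auto simp: multi_indices_def)
  from infsum_reindex_bij_betw[OF this, of g]
  have "infsum (\<lambda>(m, is). g is) (Sigma UNIV ?I) = infsum g {is. length is = length ss}"
    by (simp add: case_prod_unfold)
  ultimately show ?thesis by (simp only: tail_gf_def g_def)
qed

text \<open>The recursion of divided differences: exchanging one node and dividing by the difference
  raises the order by one. Neither series needs to be a tail generating function of distinct nodes,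
  so confluent nodes such as q, q are covered.\<close>

lemma sums_complete_hom_diff:
  assumes "a \<noteq> b"
    and A: "(\<lambda>m. v (m + k) * complete_hom (a # ss) m) sums A"
    and B: "(\<lambda>m. v (m + k) * complete_hom (b # ss) m) sums B"
  shows "(\<lambda>m. v (m + Suc k) * complete_hom (a # b # ss) m) sums ((A - B) / (a - b))"
proof -
  have "(\<lambda>m. v (m + k) * (complete_hom (a # ss) m - complete_hom (b # ss) m)) sums (A - B)"
    using sums_diff[OF A B] by (simp add: right_diff_distrib)
  \<comment> \<open>The term with \<open>m = 0\<close> may be dropped: both polynomials of degree 0
    equal 1 and cancel.\<close>
  then have "(\<lambda>m. v (Suc m + k) * (complete_hom (a # ss) (Suc m) - complete_hom (b # ss) (Suc m))) sums (A - B)"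
    by (subst sums_Suc_iff) simp
  then have "(\<lambda>m. v (m + Suc k) * ((a - b) * complete_hom (a # b # ss) m)) sums (A - B)"
    by (simp only: complete_hom_diff add_Suc_shift)
  from sums_divide[OF this, of "a - b"] show ?thesis
    using assms(1) by (simp add: mult.left_commute)
qed

section \<open>Extendable generating functions\<close>

locale extendable_gf =
  fixes q r :: real and p :: "nat \<Rightarrow> real"
  assumes extendable: "extendable q r p" and p1: "p 1 \<noteq> 1"
begin

lemma p_nonneg: "0 \<le> p k"
  using extendable by (simp add: extendable_def defective_pgf_def)

lemma p_summable: "summable (\<lambda>k. p k * r ^ k)" and gf_q: "gf p q = q" and gf_r: "gf p r = r"
  using extendable by (auto simp: extendable_def gf_def sums_iff)

lemma q_nonneg: "0 \<le> q" and q_less_r: "q < r" and r_pos: "0 < r"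
  using extendable by (auto simp: extendable_def)

lemma gf_sums: "0 \<le> x \<Longrightarrow> x \<le> r \<Longrightarrow> (\<lambda>m. p (m + 0) * complete_hom [x] m) sums gf p x"
  using gf_summable[OF p_nonneg p_summable, of x] by (simp add: complete_hom_single gf_def sums_iff)

lemma slope_sums:
  assumes "0 \<le> x" "x \<le> r" "0 \<le> y" "y \<le> r" "x \<noteq> y"
  shows "(\<lambda>m. p (m + Suc 0) * complete_hom [x, y] m) sums ((gf p x - gf p y) / (x - y))"
  by (rule sums_complete_hom_diff[OF assms(5) gf_sums[OF assms(1,2)] gf_sums[OF assms(3,4)]])

lemma slope_qr_sums: "(\<lambda>m. p (m + Suc 0) * complete_hom [q, r] m) sums 1"
  using slope_sums[of q r] q_nonneg q_less_r r_pos gf_q gf_r by simp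

text \<open>The divided difference of \<open>f\<close> at the nodes \<open>q\<close>, \<open>r\<close>, \<open>x\<close>, that is \<open>f\<^sup>(\<^sup>3\<^sup>)(q, r, x)\<close>;
  the linear part of \<open>f\<close> may be subtracted without changing it.\<close>
definition K :: "real \<Rightarrow> real" where
  "K x = (gf p x - x) / ((x - q) * (x - r))"

lemma K_sums:
  assumes "0 \<le> x" "x < r" "x \<noteq> q"
  shows "(\<lambda>m. p (m + Suc (Suc 0)) * complete_hom [x, q, r] m) sums K x"
proof -
  have "(\<lambda>m. p (m + Suc 0) * complete_hom [x, r] m) sums ((gf p x - r) / (x - r))"
    using slope_sums[of x r] assms r_pos gf_r by simp
  from sums_complete_hom_diff[OF assms(3) this slope_qr_sums]
  have "(\<lambda>m. p (m + Suc (Suc 0)) * complete_hom [x, q, r] m) sums (((gf p x - r) / (x - r) - 1) / (x - q))" .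
  also have "((gf p x - r) / (x - r) - 1) / (x - q) = K x"
  proof -
    have "(gf p x - r) / (x - r) - 1 = (gf p x - x) / (x - r)"
      using assms(2) by (simp add: field_simps)
    then show ?thesis by (simp add: K_def mult.commute)
  qed
  finally show ?thesis .
qed

text \<open>Otherwise f is affine with slope \<open>p 1\<close>, whereas the chord through its two
  fixed points has slope 1.\<close>

lemma obtain_nonlinear:
  obtains k where "0 < p (k + Suc (Suc 0))"
proof -
  have "\<exists>k. p (k + Suc (Suc 0)) \<noteq> 0"
  proof (rule ccontr)
    assume "\<not> ?thesis"
    then have "p (m + Suc 0) * complete_hom [q, r] m = (if m = 0 then p 1 else 0)" for m
      by (cases m) simp_all
    then have "(\<lambda>m. if m = 0 then p 1 else 0) sums 1" using slope_qr_sums by simp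
    moreover have "(\<lambda>m. if m = 0 then p 1 else 0) sums p 1" using sums_single[of 0 "\<lambda>_. p 1"] by simp
    ultimately show False using p1 sums_unique2 by blast
  qed
  with that p_nonneg show ?thesis by (metis order_le_less)
qed

text \<open>The nodes \<open>x\<close> and \<open>y\<close> may vanish, but the third node
  \<open>r\<close> is positive, so a single coefficient \<open>p (k + 2) > 0\<close> contributes at
  least \<open>p (k + 2) * r ^ k\<close>.\<close>

lemma sums3_pos:
  assumes "0 \<le> x" "0 \<le> y" and sums: "(\<lambda>m. p (m + Suc (Suc 0)) * complete_hom [x, y, r] m) sums S"
  shows "0 < S"
proof -
  obtain k where k: "0 < p (k + Suc (Suc 0))" by (rule obtain_nonlinear)
  have nn: "0 \<le> p (m + Suc (Suc 0)) * complete_hom [x, y, r] m" for m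
    using assms r_pos by (intro mult_nonneg_nonneg p_nonneg complete_hom_nonneg) simp
  have "r ^ k \<le> complete_hom [y, r] k"
    using complete_hom_Cons_ge[of y "[r]" k] assms r_pos by (simp add: complete_hom_single)
  also have "\<dots> \<le> complete_hom [x, y, r] k"
    using complete_hom_Cons_ge[of x "[y, r]" k] assms r_pos by simp
  finally have "0 < complete_hom [x, y, r] k"
    using r_pos by (meson less_le_trans zero_less_power)
  with k have "0 < p (k + Suc (Suc 0)) * complete_hom [x, y, r] k" by simp
  with suminf_pos2[of "\<lambda>m. p (m + Suc (Suc 0)) * complete_hom [x, y, r] m" k] sums nn
  show ?thesis by (simp add: sums_iff)
qed

lemma K_pos: "0 \<le> x \<Longrightarrow> x < r \<Longrightarrow> x \<noteq> q \<Longrightarrow> 0 < K x"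
  using sums3_pos[OF _ q_nonneg K_sums] by blast

lemma gf_minus_id: "x \<noteq> q \<Longrightarrow> x \<noteq> r \<Longrightarrow> gf p x - x = (x - q) * (x - r) * K x"
  by (simp add: K_def)

text \<open>With \<open>K\<close> positive, the sign of the drift is that of (x - q) (x -
  r).\<close>

lemma gf_greater:
  assumes "0 \<le> x" "x < q"
  shows "x < gf p x"
proof -
  have "0 < (x - q) * (x - r) * K x"
    using assms q_less_r by (intro mult_pos_pos mult_neg_neg K_pos) simp_all
  then show ?thesis using gf_minus_id[of x] assms q_less_r by simp
qed

lemma gf_less:
  assumes "q < x" "x < r"
  shows "gf p x < x"
proof -
  have "(x - q) * (x - r) * K x < 0"
    using assms q_nonneg by (intro mult_neg_pos mult_pos_neg K_pos) simp_all
  then show ?thesis using gf_minus_id[of x] assms by simp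
qed

lemma continuous_on_gf': "continuous_on {0..r} (gf p)"
  by (rule continuous_on_gf[OF p_nonneg p_summable])

lemma continuous_on_K: "S \<subseteq> {0..<r} - {q} \<Longrightarrow> continuous_on S K"
  unfolding K_def[abs_def]
  by (intro continuous_on_divide continuous_intros continuous_on_subset[OF continuous_on_gf']) auto

text \<open>The confluent divided difference f^(2)(q, q), which is f'(q). As q < r lies inside the
  disc of convergence, the series may be differentiated termwise at \<open>q\<close>.\<close>

definition deriv_q :: real where
  "deriv_q = (\<Sum>m. p (m + Suc 0) * complete_hom [q, q] m)"

lemma deriv_q:
  shows "(\<lambda>m. p (m + Suc 0) * complete_hom [q, q] m) sums deriv_q"
    and "(gf p has_real_derivative deriv_q) (at q within S)"
proof -
  have eq: "diffs p m * q ^ m = p (m + Suc 0) * complete_hom [q, q] m" for m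
    by (simp add: diffs_def complete_hom_double)
  have "summable (\<lambda>n. p n * x ^ n)" if "norm x < r" for x :: real
    by (rule powser_inside[OF p_summable]) (use that in simp)
  then have "summable (\<lambda>m. diffs p m * q ^ m)"
    using q_nonneg q_less_r by (intro termdiff_converges[of q r]) simp_all
  then show "(\<lambda>m. p (m + Suc 0) * complete_hom [q, q] m) sums deriv_q"
    unfolding eq deriv_q_def by (rule summable_sums)
  have "DERIV (\<lambda>x. \<Sum>n. p n * x ^ n) q :> (\<Sum>n. diffs p n * q ^ n)"
    using q_nonneg q_less_r by (intro termdiffs_strong[OF p_summable]) simp
  then have "(gf p has_real_derivative deriv_q) (at q)"
    unfolding eq deriv_q_def gf_def[abs_def] .
  then show "(gf p has_real_derivative deriv_q) (at q within S)"
    by (rule has_field_derivative_at_within)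
qed

end

section \<open>Finite left derivative at \<open>r\<close>: confluent nodes, gamma and psi\<close>

locale extendable_gf_diff = extendable_gf +
  fixes deriv_r :: real
  assumes deriv_r: "(gf p has_real_derivative deriv_r) (at r within {0..r})"
begin

lemma deriv_r_sums: "(\<lambda>m. p (m + Suc 0) * complete_hom [r, r] m) sums deriv_r"
proof -
  let ?c = "\<lambda>x m. p (m + Suc 0) * complete_hom [x, r] m"
  let ?F = "at r within {0..r}"
  have lim: "((\<lambda>x. (gf p x - gf p r) / (x - r)) \<longlongrightarrow> deriv_r) ?F"
    using deriv_r by (simp add: has_field_derivative_iff)
  have nontriv: "?F \<noteq> bot"
    by (simp add: at_within_Icc_at_left r_pos)
  have ev: "\<forall>\<^sub>F x in ?F. 0 \<le> x \<and> x < r"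
    by (simp add: eventually_at_filter order_le_less)
  have nn: "0 \<le> ?c x m" if "0 \<le> x" for x m
    using that r_pos by (intro mult_nonneg_nonneg p_nonneg complete_hom_nonneg) simp
  have slope: "?c x sums ((gf p x - gf p r) / (x - r))" if "0 \<le> x" "x < r" for x
    using slope_sums[of x r] that by simp
  have partial: "(\<Sum>m<n. ?c r m) \<le> deriv_r" for n
  proof (rule tendsto_le[OF nontriv lim])
    show "((\<lambda>x. \<Sum>m<n. ?c x m) \<longlongrightarrow> (\<Sum>m<n. ?c r m)) ?F"
      unfolding complete_hom_Cons[of _ "[r]"] complete_hom_single by (intro tendsto_intros)
    show "\<forall>\<^sub>F x in ?F. (\<Sum>m<n. ?c x m) \<le> (gf p x - gf p r) / (x - r)"
      using ev
    proof eventually_elim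
      case (elim x)
      then show ?case
        using slope[of x] nn[of x] sum_le_suminf[of "?c x" "{..<n}"] by (simp add: sums_iff)
    qed
  qed
  have sm: "summable (?c r)"
    using r_pos by (intro summableI_nonneg_bounded[OF _ partial] nn) simp
  have "suminf (?c r) \<le> deriv_r"
    by (rule suminf_le_const[OF sm partial])
  moreover have "deriv_r \<le> suminf (?c r)"
  proof (rule tendsto_upperbound[OF lim _ nontriv])
    show "\<forall>\<^sub>F x in ?F. (gf p x - gf p r) / (x - r) \<le> suminf (?c r)"
      using ev
    proof eventually_elim
      case (elim x)
      then have "?c x m \<le> ?c r m" for m
        using r_pos by (intro mult_left_mono complete_hom_mono p_nonneg) simp
      then show ?case
        using slope[of x] elim sm suminf_le[of "?c x" "?c r"] by (simp add: sums_iff)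
    qed
  qed
  ultimately show ?thesis using sm by (simp add: sums_iff)
qed

text \<open>These are f^(3)(q, q, r) and f^(3)(q, r, r), the values that continue \<open>K\<close>
  to the nodes, where its quotient formula has denominator 0. They equal alpha / (r - q) and beta /
  (r - q).\<close>

definition K_q :: real where "K_q = (1 - deriv_q) / (r - q)"
definition K_r :: real where "K_r = (deriv_r - 1) / (r - q)"

lemma slope_rq_sums: "(\<lambda>m. p (m + Suc 0) * complete_hom [r, q] m) sums 1"
  using slope_qr_sums complete_hom_perm[of "[q, r]" "[r, q]"] by simp

lemma K_q_sums: "(\<lambda>m. p (m + Suc (Suc 0)) * complete_hom [q, q, r] m) sums K_q"
  using sums_complete_hom_diff[OF _ slope_rq_sums deriv_q(1)] q_less_r
    complete_hom_perm[of "[r, q, q]" "[q, q, r]"] by (simp add: K_q_def)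

lemma K_r_sums: "(\<lambda>m. p (m + Suc (Suc 0)) * complete_hom [r, q, r] m) sums K_r"
  using sums_complete_hom_diff[OF _ deriv_r_sums slope_qr_sums] q_less_r by (simp add: K_r_def)

lemma K_q_pos: "0 < K_q"
  by (rule sums3_pos[OF q_nonneg q_nonneg K_q_sums])

text \<open>Replacing a node \<open>q\<close> by the larger \<open>r\<close> increases every term.
  This is alpha <= beta, the source of gamma <= 1.\<close>

lemma K_q_le_K_r: "K_q \<le> K_r"
proof (rule sums_le[OF _ K_q_sums K_r_sums])
  fix m show "p (m + Suc (Suc 0)) * complete_hom [q, q, r] m \<le> p (m + Suc (Suc 0)) * complete_hom [r, q, r] m"
    using q_nonneg q_less_r by (intro mult_left_mono complete_hom_mono p_nonneg) simp
qed

lemma K_le_K_r: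
  assumes "0 \<le> x" "x < r" "x \<noteq> q"
  shows "K x \<le> K_r"
proof (rule sums_le[OF _ K_sums[OF assms] K_r_sums])
  fix m show "p (m + Suc (Suc 0)) * complete_hom [x, q, r] m \<le> p (m + Suc (Suc 0)) * complete_hom [r, q, r] m"
    using assms q_nonneg q_less_r by (intro mult_left_mono complete_hom_mono p_nonneg) simp
qed

definition gam :: real where "gam = (1 - deriv_q) / (deriv_r - 1)"

lemma gam_eq: "gam = K_q / K_r"
  using q_less_r by (simp add: gam_def K_q_def K_r_def)

lemma gam_bounds: "0 < gam" "gam \<le> 1"
  using K_q_pos K_q_le_K_r by (simp_all add: gam_eq)

text \<open>One more step of the divided difference recursion: both f^(4) in the numerator of psi
  are slopes of \<open>K\<close>, between \<open>x\<close> and \<open>q\<close> and between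
  \<open>x\<close> and \<open>r\<close>.\<close>

lemma psi_eq:
  assumes "0 \<le> x" "x < r" "x \<noteq> q"
  shows "psi p q r gam x = ((K x - K_q) / (x - q) - gam * ((K x - K_r) / (x - r))) / K x"
proof -
  have rqr: "complete_hom [r, q, r] = complete_hom [q, r, r]" and xrqr: "complete_hom [x, r, q, r] = complete_hom [q, r, r, x]"
    and xqqr: "complete_hom [x, q, q, r] = complete_hom [q, q, r, x]" and xqr: "complete_hom [x, q, r] = complete_hom [q, r, x]"
    by (rule complete_hom_perm, simp)+
  have "(\<lambda>m. p (m + Suc (Suc (Suc 0))) * complete_hom [q, q, r, x] m) sums ((K x - K_q) / (x - q))"
    using sums_complete_hom_diff[OF _ K_sums[OF assms] K_q_sums] assms(3) by (simp only: xqqr not_False_eq_True)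
  then have 1: "tail_gf p [q, q, r, x] = (K x - K_q) / (x - q)"
    using assms q_nonneg r_pos by (intro tail_gf_eqI p_nonneg) (simp_all add: numeral_eq_Suc)
  have "(\<lambda>m. p (m + Suc (Suc (Suc 0))) * complete_hom [q, r, r, x] m) sums ((K x - K_r) / (x - r))"
    using sums_complete_hom_diff[OF _ K_sums[OF assms] K_r_sums] assms(2) unfolding xrqr by simp
  then have 2: "tail_gf p [q, r, r, x] = (K x - K_r) / (x - r)"
    using assms q_nonneg r_pos by (intro tail_gf_eqI p_nonneg) (simp_all add: numeral_eq_Suc)
  have 3: "tail_gf p [q, r, x] = K x"
    using K_sums[OF assms] assms q_nonneg r_pos unfolding xqr
    by (intro tail_gf_eqI p_nonneg) (simp_all add: numeral_eq_Suc)
  show ?thesis by (simp only: psi_def 1 2 3)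
qed

text \<open>The choice of gamma makes gamma K_r = K_q, so the terms containing K_q and K_r combine
  to (r - x) K_q + (x - q) K_q, in which x cancels; what remains is alpha.\<close>

lemma psi_times_drift:
  assumes "0 \<le> x" "x < r" "x \<noteq> q"
  shows "psi p q r gam x * (gf p x - x) = (x - r) * K x - gam * ((x - q) * K x) + (1 - deriv_q)"
proof -
  have nz: "K x \<noteq> 0" "x - q \<noteq> 0" "x - r \<noteq> 0" using K_pos[OF assms] assms by simp_all
  have "psi p q r gam x * (gf p x - x) = (x - r) * (K x - K_q) - gam * ((x - q) * (K x - K_r))"
  proof -
    have "((k - a) / u - g * ((k - b) / v)) / k * (u * v * k) = v * (k - a) - g * (u * (k - b))"
      if "k \<noteq> 0" "u \<noteq> 0" "v \<noteq> 0" for k a b g u v :: real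
      using that by (simp add: field_simps)
    from this[OF nz] show ?thesis
      by (simp only: psi_eq[OF assms] gf_minus_id[OF assms(3) less_imp_neq[OF assms(2)]])
  qed
  also have "\<dots> = (x - r) * K x - gam * ((x - q) * K x) - (x - r) * K_q + (x - q) * (gam * K_r)"
    by (simp add: algebra_simps)
  also have "gam * K_r = K_q"
    using K_q_pos K_q_le_K_r by (simp add: gam_eq)
  also have "(x - r) * K x - gam * ((x - q) * K x) - (x - r) * K_q + (x - q) * K_q =
      (x - r) * K x - gam * ((x - q) * K x) + (r - q) * K_q"
    by (simp add: algebra_simps)
  also have "(r - q) * K_q = 1 - deriv_q"
    using q_less_r by (simp add: K_q_def)
  finally show ?thesis .
qed

lemma continuous_on_psi:
  assumes "S \<subseteq> {0..<r} - {q}"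
  shows "continuous_on S (psi p q r gam)"
proof -
  have "K x \<noteq> 0" if "x \<in> S" for x
    using K_pos[of x] that assms by force
  then have "continuous_on S (\<lambda>x. ((K x - K_q) / (x - q) - gam * ((K x - K_r) / (x - r))) / K x)"
    using assms by (intro continuous_on_divide continuous_intros continuous_on_K[OF assms]) auto
  then show ?thesis
    by (rule continuous_on_eq) (use assms psi_eq in force)
qed

end

section \<open>The flow of the differential equation\<close>

lemma within_mono:
  fixes y y' :: "real \<Rightarrow> real"
  assumes deriv: "\<And>u. 0 \<le> u \<Longrightarrow> u \<le> T \<Longrightarrow> (y has_real_derivative y' u) (at u within {0..T})"
    and nonneg: "\<And>u. 0 \<le> u \<Longrightarrow> u \<le> T \<Longrightarrow> 0 \<le> y' u" and ab: "0 \<le> a" "a \<le> b" "b \<le> T"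
  shows "y a \<le> y b"
proof (rule DERIV_nonneg_imp_increasing_open[OF ab(2)])
  fix x assume x: "a < x" "x < b"
  have "at x within {0..T} = at x" using x ab by (intro at_within_Icc_at) simp_all
  then show "\<exists>d. DERIV y x :> d \<and> 0 \<le> d" using deriv[of x] nonneg[of x] x ab by auto
next
  have "continuous_on {0..T} y"
    by (rule DERIV_continuous_on[where D=y']) (rule deriv, simp_all)
  then show "continuous_on {a..b} y" by (rule continuous_on_subset) (use ab in simp)
qed

text \<open>Gronwall's argument: \<open>y u * exp (- c * u)\<close> is nondecreasing. No sign of
  \<open>y\<close> is assumed.\<close>

lemma growth_ge:
  fixes y y' :: "real \<Rightarrow> real"
  assumes deriv: "\<And>u. 0 \<le> u \<Longrightarrow> u \<le> t \<Longrightarrow> (y has_real_derivative y' u) (at u within {0..t})"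
    and ge: "\<And>u. 0 \<le> u \<Longrightarrow> u \<le> t \<Longrightarrow> c * y u \<le> y' u" and t: "0 \<le> t"
  shows "y 0 * exp (c * t) \<le> y t"
proof -
  have "y 0 * exp (- c * 0) \<le> y t * exp (- c * t)"
  proof (rule within_mono[where y="\<lambda>u. y u * exp (- c * u)" and T=t])
    fix u assume u: "0 \<le> u" "u \<le> t"
    have "((\<lambda>u. exp (- c * u)) has_real_derivative exp (- c * u) * - c) (at u within {0..t})"
      by (auto intro!: derivative_eq_intros)
    from DERIV_mult[OF deriv[OF u] this]
    show "((\<lambda>u. y u * exp (- c * u)) has_real_derivative (y' u - c * y u) * exp (- c * u)) (at u within {0..t})"
      by (rule DERIV_cong) (simp add: algebra_simps)
    show "0 \<le> (y' u - c * y u) * exp (- c * u)" using ge[OF u] by simp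
  qed (use t in simp_all)
  then have "y 0 * exp (c * t) \<le> y t * exp (- c * t) * exp (c * t)"
    by (intro mult_right_mono) simp_all
  then show ?thesis by (simp add: mult.assoc mult_exp_exp)
qed

lemma growth_le:
  fixes y y' :: "real \<Rightarrow> real"
  assumes deriv: "\<And>u. 0 \<le> u \<Longrightarrow> u \<le> t \<Longrightarrow> (y has_real_derivative y' u) (at u within {0..t})"
    and le: "\<And>u. 0 \<le> u \<Longrightarrow> u \<le> t \<Longrightarrow> y' u \<le> c * y u" and t: "0 \<le> t"
  shows "y t \<le> y 0 * exp (c * t)"
proof -
  have "- y 0 * exp (c * t) \<le> - y t"
    using le by (intro growth_ge[of t "\<lambda>u. - y u" "\<lambda>u. - y' u"] DERIV_minus deriv t) simp_all
  then show ?thesis by simp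
qed

text \<open>The form in which Gronwall bounds arrive when the growth rate is known only up to an
  arbitrary error \<open>e\<close>; continuity of exp lets \<open>e\<close> tend to 0.\<close>

lemma tendsto_exp_sandwich:
  fixes Q :: "'a \<Rightarrow> real"
  assumes "\<And>e. 0 < e \<Longrightarrow> \<forall>\<^sub>F s in A. exp ((c - e) * t) \<le> Q s \<and> Q s \<le> exp ((c + e) * t)"
  shows "(Q \<longlongrightarrow> exp (c * t)) A"
proof (rule order_tendstoI)
  fix a assume "a < exp (c * t)"
  moreover have "((\<lambda>e. exp ((c - e) * t)) \<longlongrightarrow> exp ((c - 0) * t)) (at_right 0)"
    by (intro tendsto_intros)
  ultimately have "\<forall>\<^sub>F e in at_right 0. a < exp ((c - e) * t)" by (intro order_tendstoD(1)) simp_all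
  then have "\<forall>\<^sub>F e in at_right 0. a < exp ((c - e) * t) \<and> 0 < e"
    using eventually_at_right_less by (rule eventually_conj)
  from eventually_happens'[OF _ this] obtain e where e: "a < exp ((c - e) * t)" "0 < e"
    by (auto simp: trivial_limit_at_right_real)
  show "\<forall>\<^sub>F s in A. a < Q s"
    using assms[OF e(2)] by eventually_elim (use e(1) in linarith)
next
  fix a assume "exp (c * t) < a"
  moreover have "((\<lambda>e. exp ((c + e) * t)) \<longlongrightarrow> exp ((c + 0) * t)) (at_right 0)"
    by (intro tendsto_intros)
  ultimately have "\<forall>\<^sub>F e in at_right 0. exp ((c + e) * t) < a" by (intro order_tendstoD(2)) simp_all
  then have "\<forall>\<^sub>F e in at_right 0. exp ((c + e) * t) < a \<and> 0 < e"
    using eventually_at_right_less by (rule eventually_conj)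
  from eventually_happens'[OF _ this] obtain e where e: "exp ((c + e) * t) < a" "0 < e"
    by (auto simp: trivial_limit_at_right_real)
  show "\<forall>\<^sub>F s in A. Q s < a"
    using assms[OF e(2)] by eventually_elim (use e(1) in linarith)
qed

text \<open>The interface between probability and analysis: all that the study of the trajectories
  uses about the process. The equation \<open>F t r = r\<close> is deliberately absent, since it can
  fail; it is derived below under Osgood's condition and again when f'(r) is finite.\<close>

locale gf_flow = extendable_gf +
  fixes F :: "real \<Rightarrow> real \<Rightarrow> real"
  assumes flow_0: "\<And>s. 0 \<le> s \<Longrightarrow> s \<le> r \<Longrightarrow> F 0 s = s"
    and flow_ode: "\<And>s t T. 0 \<le> s \<Longrightarrow> s \<le> r \<Longrightarrow> 0 \<le> t \<Longrightarrow> t \<le> T \<Longrightarrow>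
      ((\<lambda>t. F t s) has_real_derivative gf p (F t s) - F t s) (at t within {0..T})"
    and flow_range: "\<And>s t. 0 \<le> s \<Longrightarrow> s \<le> r \<Longrightarrow> 0 \<le> t \<Longrightarrow> 0 \<le> F t s \<and> F t s \<le> r"
    and flow_le_q: "\<And>s t. 0 \<le> s \<Longrightarrow> s \<le> q \<Longrightarrow> 0 \<le> t \<Longrightarrow> F t s \<le> q"
    and flow_mono: "\<And>s s' t. 0 \<le> s \<Longrightarrow> s \<le> s' \<Longrightarrow> s' \<le> r \<Longrightarrow> 0 \<le> t \<Longrightarrow> F t s \<le> F t s'"
begin

lemma gf_ge: "0 \<le> x \<Longrightarrow> x \<le> q \<Longrightarrow> x \<le> gf p x"
  using gf_greater[of x] gf_q by (cases "x = q") simp_all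

lemma gf_le: "q \<le> x \<Longrightarrow> x \<le> r \<Longrightarrow> gf p x \<le> x"
  using gf_less[of x] gf_q gf_r by (cases "x = q"; cases "x = r") simp_all

lemma flow_nondecreasing:
  assumes "0 \<le> s" "s \<le> q" "0 \<le> a" "a \<le> b"
  shows "F a s \<le> F b s"
proof (rule within_mono[where T=b and y="\<lambda>t. F t s"])
  fix u assume u: "0 \<le> u" "u \<le> b"
  show "((\<lambda>t. F t s) has_real_derivative gf p (F u s) - F u s) (at u within {0..b})"
    using assms q_less_r u by (intro flow_ode) simp_all
  show "0 \<le> gf p (F u s) - F u s"
    using gf_ge[of "F u s"] flow_range[of s u] flow_le_q[of s u] assms q_less_r u by simp
qed (use assms in simp_all)

lemma flow_q: "0 \<le> t \<Longrightarrow> F t q = q"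
  using flow_nondecreasing[of q 0 t] flow_le_q[of q t] flow_0[of q] q_nonneg q_less_r by simp

lemma flow_ge_q: "q \<le> s \<Longrightarrow> s \<le> r \<Longrightarrow> 0 \<le> t \<Longrightarrow> q \<le> F t s"
  using flow_mono[of q s t] flow_q[of t] q_nonneg by simp

lemma flow_nonincreasing:
  assumes "q \<le> s" "s \<le> r" "0 \<le> a" "a \<le> b"
  shows "F b s \<le> F a s"
proof -
  have s: "0 \<le> s" using assms q_nonneg by simp
  have "- F a s \<le> - F b s"
  proof (rule within_mono[where T=b and y="\<lambda>t. - F t s"])
    fix u assume u: "0 \<le> u" "u \<le> b"
    show "((\<lambda>t. - F t s) has_real_derivative - (gf p (F u s) - F u s)) (at u within {0..b})"
      using assms s u by (intro DERIV_minus flow_ode) simp_all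
    show "0 \<le> - (gf p (F u s) - F u s)"
      using gf_le[of "F u s"] flow_range[of s u] flow_ge_q[of s u] assms s u by simp
  qed (use assms in simp_all)
  then show ?thesis by simp
qed

lemma continuous_on_flow: "0 \<le> s \<Longrightarrow> s \<le> r \<Longrightarrow> continuous_on {0..T} (\<lambda>t. F t s)"
  by (rule DERIV_continuous_on[where D="\<lambda>t. gf p (F t s) - F t s"]) (rule flow_ode, simp_all)

text \<open>If the trajectory started at \<open>r\<close> left \<open>r\<close>, the time it takes to move down from \<open>b\<close> to \<open>m\<close>
  would be \<open>\<integral>\<^sub>m\<^sup>b dx / (x - f(x))\<close>, which tends to infinity as \<open>b\<close> tends to \<open>r\<close>.\<close>
lemma osgood_imp_flow_r:
  assumes osgood: "osgood q r p" and t: "0 \<le> t"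
  shows "F t r = r"
proof (rule ccontr)
  define g where "g = (\<lambda>u. F u r)"
  have r0: "0 \<le> r" "r \<le> r" using r_pos by simp_all
  assume "F t r \<noteq> r"
  then have "g t < r" using flow_range[OF r0 t] by (simp add: g_def)
  have cont: "continuous_on {0..t} g"
    unfolding g_def by (rule continuous_on_flow[OF r0])
  have g0: "g 0 = r" using flow_0[OF r0] by (simp add: g_def)
  \<comment> \<open>It is not known that \<open>g t\<close> exceeds \<open>q\<close>, where 1 / (x -
    f(x)) is singular; taking the maximum with the midpoint keeps \<open>m\<close> away from
    \<open>q\<close>.\<close>
  obtain m where m: "q < m" "g t \<le> m" "m < r"
  proof (rule that[of "max (g t) ((q + r) / 2)"])
  qed (use q_less_r \<open>g t < r\<close> in \<open>auto simp: less_max_iff_disj\<close>)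
  obtain t2 where t2: "0 \<le> t2" "t2 \<le> t" "g t2 = m"
    using IVT2'[of g t m 0] m g0 t cont by auto
  let ?h = "\<lambda>x. 1 / (x - gf p x)"
  have cont_h: "continuous_on S ?h" if "S \<subseteq> {m..<r}" for S
  proof -
    have "x - gf p x \<noteq> 0" if "x \<in> S" for x
      using gf_less[of x] that \<open>S \<subseteq> {m..<r}\<close> m by force
    moreover have "continuous_on S (gf p)"
      by (rule continuous_on_subset[OF continuous_on_gf']) (use that m q_nonneg in force)
    ultimately show ?thesis by (intro continuous_intros) auto
  qed
  have h_nonneg: "0 \<le> ?h x" if "m \<le> x" "x < r" for x
    using gf_less[of x] that m by simp
  have bound: "(\<integral>\<^sup>+x. ennreal (?h x) * indicator {m..b} x \<partial>lborel) \<le> ennreal t"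
    if b: "m \<le> b" "b < r" for b
  proof -
    \<comment> \<open>The trajectory passes \<open>b\<close> at time \<tau> and \<open>m\<close> at
      time \<open>t2\<close>; in between it decreases inside [m, b].\<close>
    obtain \<tau> where \<tau>: "0 \<le> \<tau>" "\<tau> \<le> t2" "g \<tau> = b"
      using IVT2'[of g t2 b 0] b g0 t2 continuous_on_subset[OF cont, of "{0..t2}"] by auto
    have range: "m \<le> g u \<and> g u \<le> b" if "\<tau> \<le> u" "u \<le> t2" for u
      using flow_nonincreasing[of r \<tau> u] flow_nonincreasing[of r u t2] that \<tau> t2 q_less_r
      by (simp add: g_def)
    have sub: "g ` {\<tau>..t2} \<subseteq> {m..<r}" using range b by fastforce
    have deriv: "(g has_real_derivative (gf p (g u) - g u)) (at u within {\<tau>..t2})"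
      if "\<tau> \<le> u" "u \<le> t2" for u
      unfolding g_def using that \<tau> t2 by (intro DERIV_subset[OF flow_ode[OF r0, of u t2]]) auto
    have "continuous_on {\<tau>..t2} g"
      using cont by (rule continuous_on_subset) (use \<tau> t2 in auto)
    then have "continuous_on {\<tau>..t2} (\<lambda>u. gf p (g u) - g u)"
      using sub m q_nonneg
      by (intro continuous_on_diff continuous_on_compose2[OF continuous_on_gf']) fastforce+
    from interval_integral_substitution_finite[OF \<tau>(2) deriv cont_h[OF sub] this]
    have "(LBINT y=b..m. ?h y) = (LBINT u=\<tau>..t2. (gf p (g u) - g u) *\<^sub>R ?h (g u))"
      using \<tau> t2 by simp
    also have "\<dots> = (LBINT u=\<tau>..t2. - 1)"
    proof (rule interval_integral_cong)
      fix u assume "u \<in> einterval (min (ereal \<tau>) (ereal t2)) (max (ereal \<tau>) (ereal t2))"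
      then have "\<tau> \<le> u" "u \<le> t2" using \<tau>(2) by (auto simp: einterval_def)
      then have "gf p (g u) < g u" using range[of u] m b by (intro gf_less) auto
      then show "(gf p (g u) - g u) *\<^sub>R ?h (g u) = - 1" by (simp add: field_simps)
    qed
    also have "\<dots> = - (t2 - \<tau>)" using \<tau>(2) by (simp add: interval_integral_const)
    finally have eq: "(LBINT y=m..b. ?h y) = t2 - \<tau>"
      by (subst interval_integral_endpoints_reverse) simp
    have int: "set_integrable lborel {m..b} ?h"
      by (rule borel_integrable_atLeastAtMost'[OF cont_h]) (use b in auto)
    have "(\<integral>\<^sup>+x. ennreal (?h x) * indicator {m..b} x \<partial>lborel) =
        (\<integral>\<^sup>+x. ennreal (indicator {m..b} x *\<^sub>R ?h x) \<partial>lborel)"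
      by (intro nn_integral_cong) (simp add: indicator_def)
    also have "\<dots> = ennreal (LINT x:{m..b}|lborel. ?h x)"
      unfolding set_lebesgue_integral_def
      using int h_nonneg b unfolding set_integrable_def
      by (intro nn_integral_eq_integral AE_I2) (simp_all add: indicator_def)
    also have "(LINT x:{m..b}|lborel. ?h x) = t2 - \<tau>"
      using eq b(1) by (simp add: interval_integral_Icc)
    finally show ?thesis using \<tau>(1) t2(2) by (simp add: ennreal_leI)
  qed
  \<comment> \<open>These levels start at \<open>m\<close> and increase to \<open>r\<close> without
    reaching it.\<close>
  define b where "b n = r - (r - m) / (real n + 1)" for n
  have b: "m \<le> b n" "b n < r" for n
    using m mult_right_mono[of m r "real n"] by (simp_all add: b_def field_simps)
  let ?f = "\<lambda>x. ennreal (?h x) * indicator {m..<r} x"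
  have "(\<lambda>x. indicator {m..<r} x *\<^sub>R ?h x) \<in> borel_measurable borel"
    by (intro borel_measurable_continuous_on_indicator cont_h) simp_all
  then have "(\<lambda>x. ennreal (indicator {m..<r} x *\<^sub>R ?h x)) \<in> borel_measurable borel" by simp
  also have "(\<lambda>x. ennreal (indicator {m..<r} x *\<^sub>R ?h x)) = ?f"
    by (rule ext) (simp add: indicator_def)
  finally have meas: "?f \<in> borel_measurable lborel" by simp
  \<comment> \<open>The bound is available only on the compact intervals [m, b n], while Osgood's
    integral runs over [m, r). Continuity from below of the measure with this density connects
    them.\<close>
  let ?D = "density lborel ?f"
  have "incseq (\<lambda>n. {m..b n})"
    using m by (intro incseq_SucI) (auto simp: b_def field_simps intro: order_trans)
  then have "(SUP n. emeasure ?D {m..b n}) = emeasure ?D (\<Union>n. {m..b n})"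
    by (intro SUP_emeasure_incseq) auto
  also have "(\<Union>n. {m..b n}) = {m..<r}"
  proof (intro equalityI subsetI)
    fix x assume x: "x \<in> {m..<r}"
    obtain n where n: "(r - m) / (r - x) < real n" using reals_Archimedean2 by blast
    then have "x \<le> b n" using x by (simp add: b_def field_simps)
    with x show "x \<in> (\<Union>n. {m..b n})" by auto
  qed (use b in \<open>auto intro: le_less_trans\<close>)
  also have "emeasure ?D {m..<r} = (\<integral>\<^sup>+x\<in>{m..<r}. ennreal (?h x) \<partial>lborel)"
    using meas by (subst emeasure_density) (auto intro!: nn_integral_cong simp: indicator_def)
  also have "\<dots> = \<infinity>"
    using osgood m unfolding osgood_def by blast
  finally have "(SUP n. emeasure ?D {m..b n}) = \<infinity>" .
  moreover have "(SUP n. emeasure ?D {m..b n}) \<le> ennreal t"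
  proof (rule SUP_least)
    fix n
    have "emeasure ?D {m..b n} = (\<integral>\<^sup>+x. ?f x * indicator {m..b n} x \<partial>lborel)"
      using meas by (intro emeasure_density) simp_all
    also have "\<dots> = (\<integral>\<^sup>+x. ennreal (?h x) * indicator {m..b n} x \<partial>lborel)"
      using b[of n] by (intro nn_integral_cong) (auto simp: indicator_def)
    also have "\<dots> \<le> ennreal t" by (rule bound[OF b])
    finally show "emeasure ?D {m..b n} \<le> ennreal t" .
  qed
  ultimately have "(\<infinity>::ennreal) \<le> ennreal t" by (simp only:)
  then show False by (simp add: top_unique)
qed

text \<open>Near an equilibrium \<open>c\<close> the relative growth rate of
  \<open>F u s - c\<close> is (f(x) - c) / (x - c) - 1 at x = \<open>F u s\<close>, hence close to D
  - 1 while the trajectory stays close to \<open>c\<close>. The hypothesis \<open>near\<close>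
  ensures this uniformly on [0, t], whether \<open>c\<close> attracts or repels.\<close>

lemma flow_multiplier:
  assumes c: "0 \<le> c" "c \<le> r" and fix_c: "gf p c = c" "F t c = c" and t: "0 \<le> t"
    and D: "(gf p has_real_derivative D) (at c within {0..r})"
    and near: "\<forall>\<^sub>F s in at c within {0..r}. \<forall>u. 0 \<le> u \<longrightarrow> u \<le> t \<longrightarrow>
        0 < (F u s - c) * (s - c) \<and> \<bar>F u s - c\<bar> \<le> C * \<bar>s - c\<bar>"
  shows "(F t has_real_derivative exp ((D - 1) * t)) (at c within {0..r})"
proof -
  have "((\<lambda>s. (F t s - c) / (s - c)) \<longlongrightarrow> exp ((D - 1) * t)) (at c within {0..r})"
  proof (rule tendsto_exp_sandwich)
    fix e :: real assume "0 < e"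
    then have "\<forall>\<^sub>F x in at c within {0..r}. dist ((gf p x - c) / (x - c)) D < e"
      using D fix_c(1) by (intro tendstoD) (simp_all add: has_field_derivative_iff)
    then obtain d where d: "0 < d" "\<And>x. 0 \<le> x \<Longrightarrow> x \<le> r \<Longrightarrow> x \<noteq> c \<Longrightarrow> \<bar>x - c\<bar> < d \<Longrightarrow>
        \<bar>(gf p x - c) / (x - c) - D\<bar> < e"
      unfolding eventually_at by (auto simp: dist_real_def)
    have "((\<lambda>s. C * \<bar>s - c\<bar>) \<longlongrightarrow> C * \<bar>c - c\<bar>) (at c within {0..r})"
      by (intro tendsto_intros)
    then have "\<forall>\<^sub>F s in at c within {0..r}. C * \<bar>s - c\<bar> < d"
      using d(1) by (intro order_tendstoD(2)) simp_all
    moreover have "\<forall>\<^sub>F s in at c within {0..r}. s \<in> {0..r}"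
      by (simp add: eventually_at_filter)
    ultimately show "\<forall>\<^sub>F s in at c within {0..r}. exp ((D - 1 - e) * t) \<le> (F t s - c) / (s - c) \<and>
        (F t s - c) / (s - c) \<le> exp ((D - 1 + e) * t)"
      using near
    proof eventually_elim
      case (elim s)
      then have s: "0 \<le> s" "s \<le> r" by simp_all
      \<comment> \<open>The factor \<open>s - c\<close> makes \<open>y\<close> positive on both
        sides of \<open>c\<close>, so one pair of Gronwall estimates treats both.\<close>
      define y where "y = (\<lambda>u. (F u s - c) * (s - c))"
      have y0: "y 0 = (s - c) * (s - c)" by (simp add: y_def flow_0 s)
      have pos: "0 < y u" if "0 \<le> u" "u \<le> t" for u
        using elim(3) that by (simp add: y_def)
      have deriv: "(y has_real_derivative (gf p (F u s) - F u s) * (s - c)) (at u within {0..t})"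
        if "0 \<le> u" "u \<le> t" for u
        unfolding y_def using DERIV_cmult_right[OF DERIV_diff[OF flow_ode[OF s that] DERIV_const]] by simp
      have est: "(D - 1 - e) * y u \<le> (gf p (F u s) - F u s) * (s - c) \<and>
          (gf p (F u s) - F u s) * (s - c) \<le> (D - 1 + e) * y u"
        if u: "0 \<le> u" "u \<le> t" for u
      proof -
        have ne: "F u s \<noteq> c" using pos[OF u] by (auto simp: y_def)
        have "\<bar>F u s - c\<bar> < d" using elim(1,3) u by force
        with d(2)[of "F u s"] flow_range[OF s u(1)] ne
        have "\<bar>(gf p (F u s) - c) / (F u s - c) - D\<bar> < e" by simp
        then have "D - 1 - e \<le> (gf p (F u s) - c) / (F u s - c) - 1"
          "(gf p (F u s) - c) / (F u s - c) - 1 \<le> D - 1 + e" by simp_all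
        moreover have "(gf p (F u s) - F u s) * (s - c) = ((gf p (F u s) - c) / (F u s - c) - 1) * y u"
          using ne by (simp add: y_def field_simps)
        ultimately show ?thesis
          using pos[OF u] by (metis less_imp_le mult_right_mono)
      qed
      have "y 0 * exp ((D - 1 - e) * t) \<le> y t"
        using est by (intro growth_ge[of t y, OF deriv _ t]) simp_all
      moreover have "y t \<le> y 0 * exp ((D - 1 + e) * t)"
        using est by (intro growth_le[of t y, OF deriv _ t]) simp_all
      moreover have "0 < y 0" using pos[of 0] t by simp
      moreover from this have "(F t s - c) / (s - c) = y t / y 0"
        unfolding y0 by (simp add: y_def)
      ultimately show ?case by (simp add: pos_le_divide_eq pos_divide_le_eq mult.commute)
    qed
  qed
  then show ?thesis by (simp add: has_field_derivative_iff fix_c(2))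
qed

end

section \<open>The flow when f'(r) is finite: multipliers at q and r, and the integral
  formula\<close>

locale gf_flow_diff = gf_flow q r p F + extendable_gf_diff q r p deriv_r
  for q r :: real and p :: "nat \<Rightarrow> real" and F :: "real \<Rightarrow> real \<Rightarrow> real" and deriv_r :: real
begin

lemma K_r_pos: "0 < K_r"
  using K_q_pos K_q_le_K_r by simp

text \<open>Here the finite derivative enters: \<open>K\<close> stays below \<open>K_r\<close>, so
  the drift vanishes at least linearly at \<open>r\<close>, and by Gronwall a trajectory started at
  \<open>r\<close> cannot leave it.\<close>

lemma drift_near_r:
  assumes "q \<le> x" "x \<le> r"
  shows "x - gf p x \<le> (r - q) * K_r * (r - x)"
proof (cases "x = q \<or> x = r")
  case True
  then show ?thesis using gf_q gf_r q_less_r K_r_pos by auto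
next
  case False
  then have "x - gf p x = (x - q) * K x * (r - x)"
    using gf_minus_id[of x] by (simp add: algebra_simps)
  also have "\<dots> \<le> (r - q) * K_r * (r - x)"
    using False assms q_nonneg K_le_K_r[of x] K_pos[of x] q_less_r
    by (intro mult_right_mono mult_mono) simp_all
  finally show ?thesis .
qed

lemma drift_near_q:
  assumes "0 \<le> x" "x \<le> r"
  shows "\<bar>gf p x - x\<bar> \<le> r * K_r * \<bar>x - q\<bar>"
proof (cases "x = q \<or> x = r")
  case True
  then show ?thesis using gf_q gf_r r_pos K_r_pos by auto
next
  case False
  then have "\<bar>gf p x - x\<bar> = \<bar>x - r\<bar> * K x * \<bar>x - q\<bar>"
    using gf_minus_id[of x] K_pos[of x] assms by (simp add: abs_mult)
  also have "\<dots> \<le> r * K_r * \<bar>x - q\<bar>"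
    using False assms K_le_K_r[of x] K_pos[of x]
    by (intro mult_right_mono mult_mono) simp_all
  finally show ?thesis .
qed

lemma flow_r_close:
  assumes "q \<le> s" "s \<le> r" "0 \<le> t"
  shows "r - F t s \<le> (r - s) * exp ((r - q) * K_r * t)"
proof -
  have s: "0 \<le> s" using assms q_nonneg by simp
  have "r - F t s \<le> (r - F 0 s) * exp ((r - q) * K_r * t)"
  proof (rule growth_le[where y="\<lambda>t. r - F t s"])
    fix u assume u: "0 \<le> u" "u \<le> t"
    show "((\<lambda>t. r - F t s) has_real_derivative 0 - (gf p (F u s) - F u s)) (at u within {0..t})"
      using assms s u by (intro DERIV_diff DERIV_const flow_ode) simp_all
    show "0 - (gf p (F u s) - F u s) \<le> (r - q) * K_r * (r - F u s)"
      using drift_near_r[of "F u s"] flow_range[of s u] flow_ge_q[of s u] assms s u by simp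
  qed (use assms in simp)
  then show ?thesis using flow_0 s assms by simp
qed

lemma flow_r: "0 \<le> t \<Longrightarrow> F t r = r"
  using flow_r_close[of r t] flow_range[of r t] q_less_r r_pos by simp

text \<open>A trajectory does not reach \<open>q\<close> in finite time: the drift is at most a
  constant times the distance to \<open>q\<close>, so this distance decays at most
  exponentially.\<close>

lemma flow_same_side:
  assumes "0 \<le> s" "s \<le> r" "s \<noteq> q" "0 \<le> t"
  shows "0 < (F t s - q) * (s - q)"
proof -
  define y where "y = (\<lambda>u. (F u s - q) * (s - q))"
  have "y 0 * exp (- (r * K_r) * t) \<le> y t"
  proof (rule growth_ge)
    fix u assume u: "0 \<le> u" "u \<le> t"
    have "((\<lambda>t. F t s) has_real_derivative gf p (F u s) - F u s) (at u within {0..t})"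
      using assms u by (intro flow_ode) simp_all
    from DERIV_cmult_right[OF DERIV_diff[OF this DERIV_const]]
    show "(y has_real_derivative (gf p (F u s) - F u s) * (s - q)) (at u within {0..t})"
      unfolding y_def by simp
    \<comment> \<open>The weak inequality identifies \<open>y u\<close> with a product of absolute
      values, to which the bound on the drift applies; Gronwall then makes it strict.\<close>
    have "0 \<le> y u"
    proof (cases "s < q")
      case True
      then show ?thesis unfolding y_def using flow_le_q[of s u] assms u by (intro mult_nonpos_nonpos) simp_all
    next
      case False
      then show ?thesis unfolding y_def using flow_ge_q[of s u] assms u by (intro mult_nonneg_nonneg) simp_all
    qed
    then have "y u = \<bar>F u s - q\<bar> * \<bar>s - q\<bar>" by (simp add: y_def abs_mult[symmetric])
    then have "r * K_r * y u = r * K_r * \<bar>F u s - q\<bar> * \<bar>s - q\<bar>" by simp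
    also have "\<dots> \<ge> \<bar>gf p (F u s) - F u s\<bar> * \<bar>s - q\<bar>"
      using flow_range[of s u] assms u by (intro mult_right_mono drift_near_q) simp_all
    finally have "\<bar>(gf p (F u s) - F u s) * (s - q)\<bar> \<le> r * K_r * y u"
      by (simp only: abs_mult)
    then show "- (r * K_r) * y u \<le> (gf p (F u s) - F u s) * (s - q)" by (simp add: abs_le_iff)
  qed (use assms in simp)
  moreover have "0 < y 0"
    using assms flow_0[of s] by (simp add: y_def zero_less_mult_iff) linarith
  ultimately have "0 < y t" by (meson exp_gt_zero less_le_trans mult_pos_pos)
  then show ?thesis by (simp add: y_def)
qed

lemma flow_less_r:
  assumes "0 \<le> s" "s < r" "0 \<le> t"
  shows "F t s < r"
proof (cases "s \<le> q")
  case True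
  then show ?thesis using flow_le_q[of s t] assms q_less_r by simp
next
  case False
  then show ?thesis using flow_nonincreasing[of s 0 t] flow_0[of s] assms by simp
qed

lemma flow_deriv_q:
  assumes t: "0 \<le> t"
  shows "(F t has_real_derivative exp ((deriv_q - 1) * t)) (at q within {0..r})"
\<comment> \<open>From either side trajectories move monotonically toward \<open>q\<close>, so they
  are never farther from it than at the start.\<close>
proof (rule flow_multiplier[where C=1])
  have "\<forall>\<^sub>F s in at q within {0..r}. 0 \<le> s \<and> s \<le> r \<and> s \<noteq> q"
    by (simp add: eventually_at_filter)
  then show "\<forall>\<^sub>F s in at q within {0..r}. \<forall>u. 0 \<le> u \<longrightarrow> u \<le> t \<longrightarrow>
      0 < (F u s - q) * (s - q) \<and> \<bar>F u s - q\<bar> \<le> 1 * \<bar>s - q\<bar>"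
  proof eventually_elim
    case (elim s)
    show ?case
    proof (intro allI impI conjI)
      fix u assume u: "0 \<le> u" "u \<le> t"
      show "0 < (F u s - q) * (s - q)" using flow_same_side elim u by simp
      show "\<bar>F u s - q\<bar> \<le> 1 * \<bar>s - q\<bar>"
      proof (cases "s < q")
        case True
        then show ?thesis
          using flow_nondecreasing[of s 0 u] flow_le_q[of s u] flow_0[of s] elim u by simp
      next
        case False
        then show ?thesis
          using flow_nonincreasing[of s 0 u] flow_ge_q[of s u] flow_0[of s] elim u by simp
      qed
    qed
  qed
qed (use q_nonneg q_less_r gf_q flow_q t deriv_q(2) in simp_all)

lemma flow_deriv_r:
  assumes t: "0 \<le> t"
  shows "(F t has_real_derivative exp ((deriv_r - 1) * t)) (at r within {0..r})"
\<comment> \<open>Trajectories move away from \<open>r\<close>; the constant is the bound of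
  \<open>flow_r_close\<close> at the final time.\<close>
proof (rule flow_multiplier[where C="exp ((r - q) * K_r * t)"])
  have "\<forall>\<^sub>F s in at r within {0..r}. q < s"
    by (rule order_tendstoD(1)[OF tendsto_ident_at q_less_r])
  moreover have "\<forall>\<^sub>F s in at r within {0..r}. s < r"
    by (simp add: eventually_at_filter)
  ultimately show "\<forall>\<^sub>F s in at r within {0..r}. \<forall>u. 0 \<le> u \<longrightarrow> u \<le> t \<longrightarrow>
      0 < (F u s - r) * (s - r) \<and> \<bar>F u s - r\<bar> \<le> exp ((r - q) * K_r * t) * \<bar>s - r\<bar>"
  proof eventually_elim
    case (elim s)
    show ?case
    proof (intro allI impI conjI)
      fix u assume u: "0 \<le> u" "u \<le> t"
      have less: "F u s < r" using flow_less_r[of s u] elim q_nonneg u by simp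
      then show "0 < (F u s - r) * (s - r)" using elim by (intro mult_neg_neg) simp_all
      have "r - F u s \<le> (r - s) * exp ((r - q) * K_r * u)"
        using elim u by (intro flow_r_close) simp_all
      also have "\<dots> \<le> (r - s) * exp ((r - q) * K_r * t)"
        using elim u q_less_r K_r_pos by (intro mult_left_mono) simp_all
      finally show "\<bar>F u s - r\<bar> \<le> exp ((r - q) * K_r * t) * \<bar>s - r\<bar>"
        using less elim by (simp add: mult.commute)
    qed
  qed
qed (use r_pos gf_r flow_r t deriv_r in simp_all)

lemma flow_formula:
  assumes s: "0 \<le> s" "s < r" "s \<noteq> q" and t: "0 \<le> t"
  shows "interval_lebesgue_integrable lborel (ereal s) (ereal (F t s)) (psi p q r gam)"
    and "(F t s - q) / (s - q) = exp (- (1 - deriv_q) * t) * ((r - F t s) / (r - s)) powr gam *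
      exp (LBINT x=ereal s..ereal (F t s). psi p q r gam x)"
proof -
  define g where "g = (\<lambda>u. F u s)"
  have g0: "g 0 = s" using s by (simp add: g_def flow_0)
  have side: "0 < (g u - q) / (s - q)" if "0 \<le> u" for u
    using flow_same_side[of s u] s that by (simp add: g_def zero_less_divide_iff zero_less_mult_iff)
  have less_r: "g u < r" and nonneg: "0 \<le> g u" if "0 \<le> u" for u
    using flow_less_r[of s u] flow_range[of s u] s that by (simp_all add: g_def)
  have ne: "g u \<noteq> q" if "0 \<le> u" for u using side[OF that] by auto
  have deriv: "(g has_real_derivative gf p (g u) - g u) (at u within {0..t})" if "0 \<le> u" "u \<le> t" for u
    unfolding g_def using s that by (intro flow_ode) simp_all
  have cont_g: "continuous_on {0..t} g"
    unfolding g_def using s by (intro continuous_on_flow) simp_all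
  have image: "g ` {0..t} \<subseteq> {0..<r} - {q}" using less_r nonneg ne by (simp add: image_subset_iff)
  \<comment> \<open>Both ends lie on the same side of \<open>q\<close>, so the range of integration
    misses \<open>q\<close>, which \<open>psi_eq\<close> and the continuity of psi exclude.\<close>
  have between: "{min s (g t)..max s (g t)} \<subseteq> {0..<r} - {q}"
  proof (cases "s < q")
    case True
    then have "s \<le> g t" "g t \<le> q"
      using flow_nondecreasing[of s 0 t] flow_le_q[of s t] flow_0[of s] s t by (simp_all add: g_def)
    with ne[OF t] True s q_less_r show ?thesis by auto
  next
    case False
    then have "g t \<le> s" "q \<le> g t"
      using flow_nonincreasing[of s 0 t] flow_ge_q[of s t] flow_0[of s] s t by (simp_all add: g_def)
    with ne[OF t] False s q_nonneg show ?thesis by auto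
  qed
  show "interval_lebesgue_integrable lborel (ereal s) (ereal (F t s)) (psi p q r gam)"
  proof (cases "s \<le> g t")
    case True
    then show ?thesis
      using interval_integrable_continuous_on[OF True continuous_on_psi] between by (simp add: g_def)
  next
    case False
    then have "interval_lebesgue_integrable lborel (ereal (g t)) (ereal s) (psi p q r gam)"
      using between by (intro interval_integrable_continuous_on continuous_on_psi) simp_all
    then show ?thesis
      by (subst interval_integrable_endpoints_reverse) (simp add: g_def)
  qed
  \<comment> \<open>By \<open>psi_times_drift\<close> this is the integrand after the substitution x
    = \<open>g u\<close>. It is also the derivative of \<open>H\<close>, whose quotients are
    normalized so that the logarithms have positive arguments on both sides of \<open>q\<close> and
    \<open>H 0 = 0\<close>.\<close>
  define w where "w = (\<lambda>u. (g u - r) * K (g u) - gam * ((g u - q) * K (g u)) + (1 - deriv_q))"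
  define H where "H = (\<lambda>u. ln ((g u - q) / (s - q)) - gam * ln ((r - g u) / (r - s)) + (1 - deriv_q) * u)"
  have cont_w: "continuous_on {0..t} w"
    unfolding w_def
    by (intro continuous_intros cont_g continuous_on_compose2[OF continuous_on_K[OF subset_refl] cont_g image])
  have H': "(H has_real_derivative w u) (at u within {0..t})" if u: "0 \<le> u" "u \<le> t" for u
  proof -
    have pos: "0 < (g u - q) / (s - q)" "0 < (r - g u) / (r - s)"
      using side[OF u(1)] less_r[OF u(1)] s by simp_all
    have drift: "gf p (g u) - g u = (g u - q) * (g u - r) * K (g u)"
      using gf_minus_id[of "g u"] ne[OF u(1)] less_r[OF u(1)] by simp
    let ?d = "gf p (g u) - g u"
    have "((\<lambda>u. ln ((g u - q) / (s - q))) has_real_derivative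
        1 / ((g u - q) / (s - q)) * ((?d - 0) / (s - q))) (at u within {0..t})"
      by (rule DERIV_chain2[OF DERIV_ln_divide[OF pos(1)]
        DERIV_cdivide[OF DERIV_diff[OF deriv[OF u] DERIV_const]]])
    moreover have "((\<lambda>u. ln ((r - g u) / (r - s))) has_real_derivative
        1 / ((r - g u) / (r - s)) * ((0 - ?d) / (r - s))) (at u within {0..t})"
      by (rule DERIV_chain2[OF DERIV_ln_divide[OF pos(2)]
        DERIV_cdivide[OF DERIV_diff[OF DERIV_const deriv[OF u]]]])
    ultimately have "(H has_real_derivative
        1 / ((g u - q) / (s - q)) * ((?d - 0) / (s - q)) -
        gam * (1 / ((r - g u) / (r - s)) * ((0 - ?d) / (r - s))) + (1 - deriv_q) * 1) (at u within {0..t})"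
      unfolding H_def by (intro DERIV_add DERIV_diff DERIV_cmult DERIV_ident)
    also have "1 / ((g u - q) / (s - q)) * ((?d - 0) / (s - q)) = (g u - r) * K (g u)"
      using s ne[OF u(1)] by (simp add: drift)
    also have "1 / ((r - g u) / (r - s)) * ((0 - ?d) / (r - s)) = (g u - q) * K (g u)"
    proof -
      have "0 - ?d = (r - g u) * ((g u - q) * K (g u))"
        by (simp add: drift algebra_simps)
      then show ?thesis using s less_r[OF u(1)] by simp
    qed
    also have "(g u - r) * K (g u) - gam * ((g u - q) * K (g u)) + (1 - deriv_q) * 1 = w u"
      by (simp add: w_def)
    finally show ?thesis .
  qed
  have "(LBINT y=ereal s..ereal (g t). psi p q r gam y) =
      (LBINT u=ereal 0..ereal t. (gf p (g u) - g u) *\<^sub>R psi p q r gam (g u))"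
  proof -
    have "continuous_on {0..t} (\<lambda>u. gf p (g u) - g u)"
      using image by (intro continuous_on_diff cont_g continuous_on_compose2[OF continuous_on_gf' cont_g]) auto
    from interval_integral_substitution_finite[OF t deriv continuous_on_psi[OF image] this]
    show ?thesis by (simp add: g0)
  qed
  also have "\<dots> = (LBINT u=ereal 0..ereal t. w u)"
  proof (rule interval_integral_cong)
    fix u assume "u \<in> einterval (min (ereal 0) (ereal t)) (max (ereal 0) (ereal t))"
    then have "0 \<le> u" using t by (auto simp: einterval_def)
    then show "(gf p (g u) - g u) *\<^sub>R psi p q r gam (g u) = w u"
      using psi_times_drift[of "g u"] nonneg less_r ne by (simp add: w_def mult.commute)
  qed
  also have "\<dots> = H t - H 0"
    using t cont_w H' by (intro interval_integral_FTC_finite)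
      (simp_all add: has_real_derivative_iff_has_vector_derivative[symmetric])
  also have "H 0 = 0" using s by (simp add: H_def g0)
  finally have I: "(LBINT y=ereal s..ereal (F t s). psi p q r gam y) = H t" by (simp add: g_def)
  have pos: "0 < (F t s - q) / (s - q)" "0 < (r - F t s) / (r - s)"
    using side[OF t] less_r[OF t] s by (simp_all add: g_def)
  have unit: "exp (- (1 - deriv_q) * t) * exp ((1 - deriv_q) * t) = 1"
    by (simp add: mult_exp_exp algebra_simps)
  have "exp (H t) = (F t s - q) / (s - q) * exp (- (gam * ln ((r - F t s) / (r - s)))) * exp ((1 - deriv_q) * t)"
    using pos by (simp add: H_def g_def exp_add exp_diff exp_minus field_simps)
  moreover have "((r - F t s) / (r - s)) powr gam = exp (gam * ln ((r - F t s) / (r - s)))"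
    using pos(2) by (auto simp: powr_def)
  ultimately have "exp (- (1 - deriv_q) * t) * ((r - F t s) / (r - s)) powr gam * exp (H t) =
      (F t s - q) / (s - q) * (exp (- (1 - deriv_q) * t) * exp ((1 - deriv_q) * t)) *
      (exp (gam * ln ((r - F t s) / (r - s))) * exp (- (gam * ln ((r - F t s) / (r - s)))))"
    by (simp only: mult_ac)
  also have "\<dots> = (F t s - q) / (s - q)"
    by (simp only: unit) (simp add: mult_exp_exp)
  finally show "(F t s - q) / (s - q) = exp (- (1 - deriv_q) * t) * ((r - F t s) / (r - s)) powr gam *
      exp (LBINT x=ereal s..ereal (F t s). psi p q r gam x)"
    by (simp only: I)
qed

end

section \<open>The recursive structure of the genealogical tree\<close>

text \<open>The random variable s^Z with value 0 at the graveyard. Values in \<open>ennreal\<close>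
  give it an expectation for every \<open>s\<close>, before any convergence is known.\<close>

definition zval :: "ennreal \<Rightarrow> (nat list \<Rightarrow> real) \<Rightarrow> (nat list \<Rightarrow> nat option) \<Rightarrow> real \<Rightarrow> ennreal" where
  "zval s l n t = (case Z l n t of None \<Rightarrow> 0 | Some k \<Rightarrow> s ^ k)"

text \<open>This is s^Z if every particle born by time \<open>t\<close> has generation below
  \<open>m\<close>, and 0 otherwise (\<open>trunc_val_eq\<close>). The recursion at the first split
  replaces a description of the whole tree, which has no finite depth to induct on.\<close>

primrec trunc_val :: "ennreal \<Rightarrow> nat \<Rightarrow> real \<Rightarrow> (nat list \<Rightarrow> real \<times> nat option) \<Rightarrow> ennreal" where
  "trunc_val s 0 t x = 0"
| "trunc_val s (Suc m) t x =
    (if t < fst (x []) then s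
     else case snd (x []) of None \<Rightarrow> 0
       | Some k \<Rightarrow> \<Prod>i<k. trunc_val s m (t - fst (x [])) (\<lambda>u. x (i # u)))"

lemma in_tree_Nil [simp]: "in_tree n []"
  by (simp add: in_tree_def)

lemma in_tree_Cons:
  "in_tree n (i # u) \<longleftrightarrow> (\<exists>k. n [] = Some k \<and> i < k) \<and> in_tree (\<lambda>w. n (i # w)) u"
  by (auto simp: in_tree_def All_less_Suc2)

lemma birth_time_Nil [simp]: "birth_time l [] = 0"
  by (simp add: birth_time_def)

lemma birth_time_Cons: "birth_time l (i # u) = l [] + birth_time (\<lambda>w. l (i # w)) u"
  by (simp add: birth_time_def sum.lessThan_Suc_shift del: sum.lessThan_Suc)

lemma birth_time_nonneg: "(\<And>u. 0 \<le> l u) \<Longrightarrow> 0 \<le> birth_time l u"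
  by (simp add: birth_time_def sum_nonneg)

lemma born_Nil: "0 \<le> t \<Longrightarrow> [] \<in> born l n t"
  by (simp add: born_def)

lemma born_before_split:
  assumes "\<And>u. 0 \<le> l u" "0 \<le> t" "t < l []"
  shows "born l n t = {[]}"
proof -
  have "u = []" if "u \<in> born l n t" for u
  proof (cases u)
    case (Cons i w)
    have "0 \<le> birth_time (\<lambda>w. l (i # w)) w"
      using assms(1) by (intro birth_time_nonneg)
    with that Cons assms(3) show ?thesis
      by (simp add: born_def birth_time_Cons)
  qed simp
  with born_Nil[of t l n, OF assms(2)] show ?thesis by blast
qed

lemma born_after_split:
  assumes "0 \<le> t" "n [] = Some k"
  shows "born l n t =
    insert [] (\<Union>i<k. (#) i ` born (\<lambda>u. l (i # u)) (\<lambda>u. n (i # u)) (t - l []))"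
proof (intro set_eqI)
  fix u
  have shift: "l [] + x \<le> t \<longleftrightarrow> x \<le> t - l []" for x by linarith
  show "u \<in> born l n t \<longleftrightarrow>
    u \<in> insert [] (\<Union>i<k. (#) i ` born (\<lambda>u. l (i # u)) (\<lambda>u. n (i # u)) (t - l []))"
  proof (cases u)
    case Nil
    with assms show ?thesis by (simp add: born_def)
  next
    case (Cons i w)
    have "u \<in> born l n t \<longleftrightarrow> i < k \<and> w \<in> born (\<lambda>u. l (i # u)) (\<lambda>u. n (i # u)) (t - l [])"
      using assms(2) by (simp add: Cons born_def in_tree_Cons birth_time_Cons shift)
    also have "\<dots> \<longleftrightarrow> u \<in> insert [] (\<Union>i<k. (#) i ` born (\<lambda>u. l (i # u)) (\<lambda>u. n (i # u)) (t - l []))"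
      unfolding Cons by blast
    finally show ?thesis .
  qed
qed

lemma zval_before_split:
  assumes "\<And>u. 0 \<le> l u" "0 \<le> t" "t < l []"
  shows "zval s l n t = s"
proof -
  have "t < birth_time l [] + l []" using assms(3) by simp
  then have "alive l n t = {[]}" "\<not> terminated l n t"
    unfolding alive_def terminated_def born_before_split[of l t n, OF assms] by (fast, simp)
  with born_before_split[of l t n, OF assms] show ?thesis by (simp add: zval_def Z_def)
qed

lemma zval_graveyard:
  assumes "0 \<le> t" "l [] \<le> t" "n [] = None"
  shows "zval s l n t = 0"
proof -
  have "terminated l n t"
    unfolding terminated_def
    using assms by (intro bexI[of _ "[]"] born_Nil conjI) simp_all
  then show ?thesis by (simp add: zval_def Z_def)
qed

text \<open>Population sizes of the subtrees add, so the powers multiply. Termination or explosion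
  in one subtree gives a factor 0, in agreement with the value assigned to the whole tree.\<close>

lemma zval_after_split:
  assumes "0 \<le> t" "l [] \<le> t" and k: "n [] = Some k"
  shows "zval s l n t = (\<Prod>i<k. zval s (\<lambda>u. l (i # u)) (\<lambda>u. n (i # u)) (t - l []))"
proof -
  let ?l = "\<lambda>i u. l (i # u)" and ?n = "\<lambda>i u. n (i # u)"
  let ?b = "\<lambda>i. born (?l i) (?n i) (t - l [])" and ?a = "\<lambda>i. alive (?l i) (?n i) (t - l [])"
    and ?d = "\<lambda>i. terminated (?l i) (?n i) (t - l [])"
  note born = born_after_split[of t n k l, OF assms(1) k]
  have d: "terminated l n t \<longleftrightarrow> (\<exists>i<k. ?d i)"
  proof -
    have "l [] + x + y \<le> t \<longleftrightarrow> x + y \<le> t - l []" for x y by linarith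
    then show ?thesis
      unfolding terminated_def born using k by (auto simp: birth_time_Cons)
  qed
  have a: "alive l n t = (\<Union>i<k. (#) i ` ?a i)"
    unfolding alive_def born using assms(2) by (auto simp: birth_time_Cons)
  have b: "finite (born l n t) \<longleftrightarrow> (\<forall>i<k. finite (?b i))"
    unfolding born by (auto simp: finite_image_iff inj_on_def)
  show ?thesis
  proof (cases "\<exists>i<k. ?d i \<or> infinite (?b i)")
    case True
    then obtain i where i: "i < k" "?d i \<or> infinite (?b i)" by blast
    then have "zval s (?l i) (?n i) (t - l []) = 0" by (auto simp: zval_def Z_def)
    moreover have "zval s l n t = 0" using i d b by (auto simp: zval_def Z_def)
    ultimately show ?thesis using i(1) prod_zero[of "{..<k}" "\<lambda>i. zval s (?l i) (?n i) (t - l [])"] by auto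
  next
    case False
    have "finite (?a i)" if "i < k" for i
      using False that by (intro finite_subset[of "?a i" "?b i"]) (auto simp: alive_def)
    then have "card (alive l n t) = (\<Sum>i<k. card (?a i))"
      unfolding a by (subst card_UN_disjoint) (auto simp: card_image inj_on_def)
    moreover have "\<not> terminated l n t" "finite (born l n t)" using False d b by auto
    ultimately show ?thesis using False by (simp add: zval_def Z_def power_sum)
  qed
qed

lemma trunc_val_eq:
  assumes "\<And>u. 0 \<le> l u" "0 \<le> t"
  shows "trunc_val s m t (\<lambda>u. (l u, n u)) =
    (if \<forall>u\<in>born l n t. length u < m then zval s l n t else 0)"
  using assms
proof (induction m arbitrary: l n t)
  case 0
  with born_Nil[of t l n] show ?case by auto
next
  case (Suc m)
  show ?case
  proof (cases "t < l []")
    case True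
    with born_before_split[of l t n] zval_before_split[of l t s n, OF Suc.prems] Suc.prems show ?thesis by simp
  next
    case False
    show ?thesis
    proof (cases "n []")
      case None
      with False zval_graveyard[of t l n s] Suc.prems show ?thesis by simp
    next
      case (Some k)
      let ?b = "\<lambda>i. born (\<lambda>u. l (i # u)) (\<lambda>u. n (i # u)) (t - l [])"
      have "trunc_val s (Suc m) t (\<lambda>u. (l u, n u)) =
          (\<Prod>i<k. if \<forall>u\<in>?b i. length u < m
             then zval s (\<lambda>u. l (i # u)) (\<lambda>u. n (i # u)) (t - l []) else 0)"
        using False Some Suc.prems by (simp add: Suc.IH)
      moreover have "(\<forall>u\<in>born l n t. length u < Suc m) \<longleftrightarrow> (\<forall>i<k. \<forall>u\<in>?b i. length u < m)"
        by (subst born_after_split[of t n k l, OF Suc.prems(2) Some]) auto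
      moreover have "(\<Prod>i<k. if \<forall>u\<in>?b i. length u < m
             then zval s (\<lambda>u. l (i # u)) (\<lambda>u. n (i # u)) (t - l []) else 0) =
          (if \<forall>i<k. \<forall>u\<in>?b i. length u < m then zval s l n t else 0)"
      proof (cases "\<forall>i<k. \<forall>u\<in>?b i. length u < m")
        case True
        then show ?thesis
          using zval_after_split[of t l n k s] False Some Suc.prems(2) by simp
      next
        case ex: False
        then obtain i where "i < k" "\<not> (\<forall>u\<in>?b i. length u < m)" by blast
        then have "(\<Prod>i<k. if \<forall>u\<in>?b i. length u < m
             then zval s (\<lambda>u. l (i # u)) (\<lambda>u. n (i # u)) (t - l []) else 0) = 0"
          by (intro prod_zero) (simp, rule bexI[of _ i], auto)
        then show ?thesis by (simp only: if_not_P[OF ex])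
      qed
      ultimately show ?thesis by simp
    qed
  qed
qed

lemma prod_mono_ennreal:
  fixes f g :: "'a \<Rightarrow> ennreal"
  assumes "\<And>i. i \<in> A \<Longrightarrow> f i \<le> g i"
  shows "prod f A \<le> prod g A"
  using assms by (induction A rule: infinite_finite_induct) (simp_all add: mult_mono)

lemma trunc_val_mono: "mono (\<lambda>m. trunc_val s m t x)"
proof (rule incseq_SucI)
  fix m show "trunc_val s m t x \<le> trunc_val s (Suc m) t x"
  proof (induction m arbitrary: t x)
    case (Suc m)
    show ?case
      unfolding trunc_val.simps(2)[of s m t x] trunc_val.simps(2)[of s "Suc m" t x]
      by (simp split: option.split add: prod_mono_ennreal Suc.IH del: trunc_val.simps)
  qed simp
qed

text \<open>If finitely many particles are born, their generations are bounded and truncation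
  eventually has no effect. After an explosion \<open>zval\<close> is 0 by the convention in
  \<open>Z\<close>, which the truncations do not exceed.\<close>

lemma SUP_trunc_val:
  assumes "\<And>u. 0 \<le> l u" "0 \<le> t"
  shows "(SUP m. trunc_val s m t (\<lambda>u. (l u, n u))) = zval s l n t"
proof (rule antisym)
  show "(SUP m. trunc_val s m t (\<lambda>u. (l u, n u))) \<le> zval s l n t"
    by (intro SUP_least) (simp add: trunc_val_eq assms)
  show "zval s l n t \<le> (SUP m. trunc_val s m t (\<lambda>u. (l u, n u)))"
  proof (cases "finite (born l n t)")
    case True
    then have "finite (length ` born l n t)" by simp
    then obtain m where "\<forall>u\<in>born l n t. length u < m"
      unfolding finite_nat_set_iff_bounded by blast
    then have "zval s l n t = trunc_val s m t (\<lambda>u. (l u, n u))" by (simp add: trunc_val_eq assms)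
    also have "\<dots> \<le> (SUP m. trunc_val s m t (\<lambda>u. (l u, n u)))" by (rule SUP_upper) simp
    finally show ?thesis .
  qed (simp add: zval_def Z_def)
qed

section \<open>Expectations of the truncated values\<close>

definition gf_ennreal :: "(nat \<Rightarrow> real) \<Rightarrow> ennreal \<Rightarrow> ennreal" where
  "gf_ennreal v y = (\<Sum>k. ennreal (v k) * y ^ k)"

primrec trunc_mean :: "(nat \<Rightarrow> real) \<Rightarrow> ennreal \<Rightarrow> nat \<Rightarrow> real \<Rightarrow> ennreal" where
  "trunc_mean v s 0 t = 0"
| "trunc_mean v s (Suc m) t =
    (\<integral>\<^sup>+l. ennreal (exponential_density 1 l) *
       (if t < l then s else gf_ennreal v (trunc_mean v s m (t - l))) \<partial>lborel)"

abbreviation mark_space :: "(real \<times> nat option) measure" where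
  "mark_space \<equiv> borel \<Otimes>\<^sub>M count_space UNIV"

lemma borel_measurable_gf_ennreal [measurable]: "gf_ennreal v \<in> borel_measurable borel"
  unfolding gf_ennreal_def by measurable

text \<open>Reads the marks of a subtree off a larger family. The index set \<open>J\<close> is left
  free because independence is formulated for families restricted to the labels of one
  subtree.\<close>

lemma measurable_shift:
  assumes "\<And>u. h u \<in> J" "f \<in> measurable M (PiM J (\<lambda>_. N))"
  shows "(\<lambda>z u. f z (h u)) \<in> measurable M (PiM UNIV (\<lambda>_. N))"
proof -
  have "(\<lambda>z. restrict (\<lambda>u. f z (h u)) UNIV) \<in> measurable M (PiM UNIV (\<lambda>_. N))"
    by (intro measurable_restrict measurable_compose[OF assms(2)] measurable_component_singleton assms(1))
  then show ?thesis by (simp add: restrict_def)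
qed

text \<open>Measurability has to be joint in time and marks, since the subtrees are evaluated at the
  random remaining time.\<close>

lemma measurable_trunc_val:
  "(\<lambda>z. trunc_val s m (fst z) (snd z)) \<in> borel_measurable (borel \<Otimes>\<^sub>M PiM UNIV (\<lambda>_. mark_space))"
proof (induction m)
  case (Suc m)
  let ?S = "borel \<Otimes>\<^sub>M PiM UNIV (\<lambda>_::nat list. mark_space) :: (real \<times> (nat list \<Rightarrow> real \<times> nat option)) measure"
  have root: "(\<lambda>z. snd z []) \<in> measurable ?S mark_space"
    by (rule measurable_compose[OF measurable_snd measurable_component_singleton]) simp
  note life [measurable] = measurable_compose[OF root measurable_fst]
    and off [measurable] = measurable_compose[OF root measurable_snd]
  have pair: "(\<lambda>z. (fst z - fst (snd z []), \<lambda>u. snd z (i # u))) \<in> measurable ?S ?S" for i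
    by (rule measurable_Pair[OF borel_measurable_diff[OF measurable_fst life]
      measurable_shift[where f=snd and h="\<lambda>u. i # u" and J=UNIV, OF UNIV_I measurable_snd]])
  have sub [measurable]: "(\<lambda>z. trunc_val s m (fst z - fst (snd z [])) (\<lambda>u. snd z (i # u)))
      \<in> borel_measurable ?S" for i
    using measurable_compose[OF pair Suc.IH] by (simp only: fst_conv snd_conv)
  have "(\<lambda>z. case k of None \<Rightarrow> 0 | Some k \<Rightarrow>
      \<Prod>i<k. trunc_val s m (fst z - fst (snd z [])) (\<lambda>u. snd z (i # u))) \<in> borel_measurable ?S" for k
    by (cases k) (simp_all only: option.case, (intro borel_measurable_const borel_measurable_prod_ennreal sub)+)
  then have "(\<lambda>z. (\<lambda>k z. case k of None \<Rightarrow> 0 | Some k \<Rightarrow>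
      \<Prod>i<k. trunc_val s m (fst z - fst (snd z [])) (\<lambda>u. snd z (i # u))) (snd (snd z [])) z)
      \<in> borel_measurable ?S"
    by (rule measurable_compose_countable'[where I=UNIV]) (rule off, simp)
  then show ?case
    unfolding trunc_val.simps
    by (intro measurable_If borel_measurable_const) (simp_all only: life , measurable)
qed simp

lemma measurable_trunc_val_comp:
  assumes "f \<in> borel_measurable M" "g \<in> measurable M (PiM UNIV (\<lambda>_. mark_space))"
  shows "(\<lambda>z. trunc_val s m (f z) (g z)) \<in> borel_measurable M"
  using measurable_compose[OF measurable_Pair[OF assms] measurable_trunc_val] by simp

lemma borel_measurable_trunc_mean [measurable]: "trunc_mean v s m \<in> borel_measurable borel"
proof (induction m)
  case (Suc m)
  note [measurable] = Suc.IH
  have "(\<lambda>t. trunc_mean v s (Suc m) t) \<in> borel_measurable borel"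
    unfolding trunc_mean.simps by measurable
  then show ?case by simp
next
  case 0
  have "trunc_mean v s 0 = (\<lambda>t. 0)" by (rule ext) simp
  then show ?case by (simp only: borel_measurable_const)
qed

context branching_process
begin

definition mark :: "nat list \<Rightarrow> 'w \<Rightarrow> real \<times> nat option" where
  "mark u \<omega> = (L u \<omega>, N u \<omega>)"

lemma indep_mark: "indep_vars (\<lambda>_. mark_space) mark UNIV"
  using indep_pairs by (simp add: mark_def[abs_def])

lemma measurable_mark [measurable]: "mark u \<in> measurable M mark_space"
  using indep_mark unfolding indep_vars_def by blast

lemma measurable_N [measurable]: "N u \<in> measurable M (count_space UNIV)"
  using measurable_compose[OF measurable_mark measurable_snd] by (simp add: mark_def)

lemma measurable_L [measurable]: "L u \<in> borel_measurable M"
  using measurable_compose[OF measurable_mark measurable_fst] by (simp add: mark_def)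

lemma distr_mark:
  "distr M mark_space (mark u) =
    density lborel (exponential_density 1) \<Otimes>\<^sub>M distr M (count_space UNIV) (N u)"
proof (rule pair_measure_eqI[symmetric])
  have L: "distr M borel (L u) = density lborel (exponential_density 1)"
    using distributed_distr_eq_density[OF life_length[of u]] by (simp cong: distr_cong)
  interpret L: prob_space "density lborel (exponential_density 1)"
    unfolding L[symmetric] by (rule prob_space_distr) simp
  interpret N: prob_space "distr M (count_space UNIV) (N u)" by (rule prob_space_distr) simp
  show "sigma_finite_measure (density lborel (exponential_density 1))" ..
  show "sigma_finite_measure (distr M (count_space UNIV) (N u))" ..
  show "sets (density lborel (exponential_density 1) \<Otimes>\<^sub>M distr M (count_space UNIV) (N u)) =
      sets (distr M mark_space (mark u))"
    unfolding sets_distr by (intro sets_pair_measure_cong) simp_all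
  fix A B
  assume "A \<in> sets (density lborel (exponential_density 1))"
    and "B \<in> sets (distr M (count_space UNIV) (N u))"
  then have A: "A \<in> sets borel" and B: "B \<in> sets (count_space UNIV)" by simp_all
  have "prob ((L u -` A \<inter> space M) \<inter> (N u -` B \<inter> space M)) =
      prob (L u -` A \<inter> space M) * prob (N u -` B \<inter> space M)"
    using A B by (intro indep_setD[OF indep_within]) blast+
  moreover have "(L u -` A \<inter> space M) \<inter> (N u -` B \<inter> space M) = mark u -` (A \<times> B) \<inter> space M"
    by (auto simp: mark_def)
  ultimately have "emeasure (distr M borel (L u)) A * emeasure (distr M (count_space UNIV) (N u)) B =
      emeasure (distr M mark_space (mark u)) (A \<times> B)"
    using A B by (simp add: emeasure_distr emeasure_eq_measure ennreal_mult)
  then show "emeasure (density lborel (exponential_density 1)) A * emeasure (distr M (count_space UNIV) (N u)) B =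
      emeasure (distr M mark_space (mark u)) (A \<times> B)"
    by (simp only: L)
qed

lemma nn_integral_offspring:
  assumes "h None = 0"
  shows "(\<integral>\<^sup>+n. h n \<partial>distr M (count_space UNIV) (N u)) = (\<Sum>k. ennreal (p k) * h (Some k))"
proof -
  let ?D = "distr M (count_space UNIV) (N u)"
  have pk: "emeasure ?D {Some k} = ennreal (p k)" for k
    using offspring_Some[of u k] by (simp add: emeasure_distr emeasure_eq_measure vimage_def Int_def conj_commute)
  have decomp: "h n = (\<Sum>k. h (Some k) * indicator {Some k} n)" for n
  proof (cases n)
    case (Some j)
    have "(\<Sum>k. h (Some k) * indicator {Some k} n) = (\<Sum>k\<in>{j}. h (Some k) * indicator {Some k} n)"
      by (rule suminf_finite) (simp_all add: Some)
    then show ?thesis by (simp add: Some)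
  qed (simp add: assms)
  have "(\<integral>\<^sup>+n. h n \<partial>?D) = (\<integral>\<^sup>+n. (\<Sum>k. h (Some k) * indicator {Some k} n) \<partial>?D)"
    by (rule nn_integral_cong) (rule decomp)
  also have "\<dots> = (\<Sum>k. h (Some k) * emeasure ?D {Some k})"
    by (subst nn_integral_suminf) (simp_all add: nn_integral_cmult_indicator)
  finally show ?thesis by (simp only: pk mult.commute)
qed

text \<open>Subtrees of different children of \<open>v\<close> use disjoint sets of labels and are
  therefore independent.\<close>

lemma nn_integral_prod_subtrees:
  assumes "\<And>i. (\<integral>\<^sup>+\<omega>. trunc_val s m t (\<lambda>u. mark (v @ i # u) \<omega>) \<partial>M) = c"
  shows "(\<integral>\<^sup>+\<omega>. (\<Prod>i<k. trunc_val s m t (\<lambda>u. mark (v @ i # u) \<omega>)) \<partial>M) = c ^ k"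
proof -
  let ?K = "\<lambda>i. range (\<lambda>u. v @ i # u)"
  have "disjoint_family_on ?K {..<k}"
    unfolding disjoint_family_on_def by fastforce
  then have "indep_vars (\<lambda>i. PiM (?K i) (\<lambda>_. mark_space)) (\<lambda>i \<omega>. restrict (\<lambda>u. mark u \<omega>) (?K i)) {..<k}"
    by (intro indep_vars_restrict[OF indep_mark]) auto
  moreover have "(\<lambda>y. trunc_val s m t (\<lambda>u. y (v @ i # u))) \<in> borel_measurable (PiM (?K i) (\<lambda>_. mark_space))" for i
    by (intro measurable_trunc_val_comp measurable_shift[where f="\<lambda>y. y" and h="\<lambda>u. v @ i # u" and J="?K i"]) auto
  ultimately have "indep_vars (\<lambda>_. borel)
      (\<lambda>i \<omega>. trunc_val s m t (\<lambda>u. restrict (\<lambda>u. mark u \<omega>) (?K i) (v @ i # u))) {..<k}"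
    by (rule indep_vars_compose2)
  then have "indep_vars (\<lambda>_. borel) (\<lambda>i \<omega>. trunc_val s m t (\<lambda>u. mark (v @ i # u) \<omega>)) {..<k}"
    by simp
  then have "(\<integral>\<^sup>+\<omega>. (\<Prod>i<k. trunc_val s m t (\<lambda>u. mark (v @ i # u) \<omega>)) \<partial>M) =
      (\<Prod>i<k. \<integral>\<^sup>+\<omega>. trunc_val s m t (\<lambda>u. mark (v @ i # u) \<omega>) \<partial>M)"
    by (intro indep_vars_nn_integral) auto
  then show ?thesis by (simp add: assms)
qed

text \<open>Stated for the subtree at an arbitrary label \<open>v\<close>, so that the induction
  hypothesis applies to the children \<open>v @ [i]\<close>. That all subtrees have the same mean
  thus comes out of the induction itself.\<close>

lemma nn_integral_trunc_val:
  "(\<integral>\<^sup>+\<omega>. trunc_val s m t (\<lambda>u. mark (v @ u) \<omega>) \<partial>M) = trunc_mean p s m t"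
proof (induction m arbitrary: t v)
  case (Suc m)
  let ?K = "{u. \<exists>i w. u = v @ i # w}"
  let ?P = "PiM ?K (\<lambda>_. mark_space)"
  let ?R = "\<lambda>\<omega>. restrict (\<lambda>u. mark u \<omega>) ?K"
  \<comment> \<open>\<Phi> separates the mark \<open>a\<close> of \<open>v\<close> from the
    independent marks \<open>y\<close> strictly below \<open>v\<close>; \<phi> is what remains after
    \<open>y\<close> has been integrated out.\<close>
  define \<Phi> where "\<Phi> = (\<lambda>a y. if t < fst a then s else case snd a of None \<Rightarrow> 0
      | Some k \<Rightarrow> \<Prod>i<k. trunc_val s m (t - fst a) (\<lambda>u. y (v @ i # u)))"
  define \<phi> where "\<phi> = (\<lambda>l n. if t < l then s else case n of None \<Rightarrow> 0
      | Some k \<Rightarrow> trunc_mean p s m (t - l) ^ k)"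
  have \<Phi>: "(\<lambda>z. \<Phi> (fst z) (snd z)) \<in> borel_measurable (mark_space \<Otimes>\<^sub>M ?P)"
  proof -
    have [measurable]: "(\<lambda>z. trunc_val s m (t - fst (fst z)) (\<lambda>u. snd z (v @ i # u)))
        \<in> borel_measurable (mark_space \<Otimes>\<^sub>M ?P)" for i
      by (intro measurable_trunc_val_comp measurable_shift[where f=snd and h="\<lambda>u. v @ i # u" and J="?K"]) auto
    have "(\<lambda>z. case k of None \<Rightarrow> 0 | Some k \<Rightarrow>
        \<Prod>i<k. trunc_val s m (t - fst (fst z)) (\<lambda>u. snd z (v @ i # u)))
        \<in> borel_measurable (mark_space \<Otimes>\<^sub>M ?P)" for k
      by (cases k) simp_all
    then have "(\<lambda>z. (\<lambda>k z. case k of None \<Rightarrow> 0 | Some k \<Rightarrow>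
        \<Prod>i<k. trunc_val s m (t - fst (fst z)) (\<lambda>u. snd z (v @ i # u))) (snd (fst z)) z)
        \<in> borel_measurable (mark_space \<Otimes>\<^sub>M ?P)"
      by (rule measurable_compose_countable'[where I=UNIV]) measurable
    then show ?thesis unfolding \<Phi>_def by measurable
  qed
  have \<phi>: "(\<lambda>z. \<phi> (fst z) (snd z)) \<in> borel_measurable mark_space"
  proof -
    have "(\<lambda>z. case k of None \<Rightarrow> 0 | Some k \<Rightarrow> trunc_mean p s m (t - fst z) ^ k)
        \<in> borel_measurable mark_space" for k
      by (cases k) simp_all
    then have "(\<lambda>z. (\<lambda>k z. case k of None \<Rightarrow> 0 | Some k \<Rightarrow> trunc_mean p s m (t - fst z) ^ k) (snd z) z)
        \<in> borel_measurable mark_space"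
      by (rule measurable_compose_countable'[where I=UNIV]) measurable
    then show ?thesis unfolding \<phi>_def by measurable
  qed
  let ?V = "PiM {v} (\<lambda>_. mark_space)" and ?r = "\<lambda>\<omega>. restrict (\<lambda>u. mark u \<omega>) {v}"
  have "indep_var ?V ?r ?P ?R"
    by (intro indep_var_restrict[OF indep_mark]) auto
  then have joint: "distr M (?V \<Otimes>\<^sub>M ?P) (\<lambda>\<omega>. (?r \<omega>, ?R \<omega>)) = distr M ?V ?r \<Otimes>\<^sub>M distr M ?P ?R"
    and r: "?r \<in> measurable M ?V" and R: "?R \<in> measurable M ?P"
    unfolding indep_var_distribution_eq by simp_all
  have root: "(\<lambda>y. y v) \<in> measurable ?V mark_space" by simp
  have \<Phi>': "(\<lambda>z. \<Phi> (fst z v) (snd z)) \<in> borel_measurable (?V \<Otimes>\<^sub>M ?P)"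
    using measurable_compose[OF measurable_Pair[OF measurable_compose[OF measurable_fst root] measurable_snd] \<Phi>]
    by simp
  interpret R: prob_space "distr M ?P ?R" by (rule prob_space_distr[OF R])
  interpret N: prob_space "distr M (count_space UNIV) (N v)" by (rule prob_space_distr) simp
  have inner: "(\<integral>\<^sup>+y. \<Phi> a y \<partial>distr M ?P ?R) = \<phi> (fst a) (snd a)" for a
  proof -
    have "\<Phi> a \<in> borel_measurable ?P"
      using measurable_compose[OF measurable_Pair1' \<Phi>, of a] by (simp add: space_pair_measure)
    then have "(\<integral>\<^sup>+y. \<Phi> a y \<partial>distr M ?P ?R) = (\<integral>\<^sup>+\<omega>. \<Phi> a (?R \<omega>) \<partial>M)"
      using R by (simp add: nn_integral_distr)
    also have "\<dots> = \<phi> (fst a) (snd a)"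
    proof (cases "snd a")
      case (Some k)
      have "(\<integral>\<^sup>+\<omega>. trunc_val s m (t - fst a) (\<lambda>u. mark (v @ i # u) \<omega>) \<partial>M) =
          trunc_mean p s m (t - fst a)" for i
        using Suc.IH[of "t - fst a" "v @ [i]"] by simp
      from nn_integral_prod_subtrees[OF this] Some show ?thesis
        by (simp add: \<Phi>_def \<phi>_def emeasure_space_1)
    qed (simp add: \<Phi>_def \<phi>_def emeasure_space_1)
    finally show ?thesis .
  qed
  have offspring: "(\<integral>\<^sup>+n. \<phi> l n \<partial>distr M (count_space UNIV) (N v)) =
      (if t < l then s else gf_ennreal p (trunc_mean p s m (t - l)))" for l
  proof (cases "t < l")
    case True
    then show ?thesis using N.emeasure_space_1 by (simp add: \<phi>_def)
  next
    case False
    then show ?thesis by (subst nn_integral_offspring) (simp_all add: \<phi>_def gf_ennreal_def)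
  qed
  have "(\<integral>\<^sup>+\<omega>. trunc_val s (Suc m) t (\<lambda>u. mark (v @ u) \<omega>) \<partial>M) = (\<integral>\<^sup>+\<omega>. \<Phi> (mark v \<omega>) (?R \<omega>) \<partial>M)"
  proof (rule nn_integral_cong)
    fix \<omega>
    show "trunc_val s (Suc m) t (\<lambda>u. mark (v @ u) \<omega>) = \<Phi> (mark v \<omega>) (?R \<omega>)"
      by (cases "snd (mark v \<omega>)") (simp_all add: \<Phi>_def)
  qed
  also have "\<dots> = (\<integral>\<^sup>+z. \<Phi> (fst z v) (snd z) \<partial>distr M (?V \<Otimes>\<^sub>M ?P) (\<lambda>\<omega>. (?r \<omega>, ?R \<omega>)))"
    using \<Phi>' r R by (simp add: nn_integral_distr)
  also have "\<dots> = (\<integral>\<^sup>+y. (\<integral>\<^sup>+z. \<Phi> (y v) z \<partial>distr M ?P ?R) \<partial>distr M ?V ?r)"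
    unfolding joint using \<Phi>' by (subst R.nn_integral_fst[symmetric]) simp_all
  also have "\<dots> = (\<integral>\<^sup>+y. \<phi> (fst (y v)) (snd (y v)) \<partial>distr M ?V ?r)"
    by (simp only: inner)
  also have "\<dots> = (\<integral>\<^sup>+\<omega>. \<phi> (fst (mark v \<omega>)) (snd (mark v \<omega>)) \<partial>M)"
    using measurable_compose[OF root \<phi>] r by (simp add: nn_integral_distr)
  also have "\<dots> = (\<integral>\<^sup>+a. \<phi> (fst a) (snd a) \<partial>distr M mark_space (mark v))"
    using \<phi> by (simp add: nn_integral_distr)
  also have "\<dots> = (\<integral>\<^sup>+a. \<phi> (fst a) (snd a) \<partial>(density lborel (exponential_density 1) \<Otimes>\<^sub>M distr M (count_space UNIV) (N v)))"
    by (simp only: distr_mark)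
  also have "\<dots> = (\<integral>\<^sup>+l. (\<integral>\<^sup>+n. \<phi> l n \<partial>distr M (count_space UNIV) (N v)) \<partial>density lborel (exponential_density 1))"
    using \<phi> by (subst N.nn_integral_fst[symmetric]) simp_all
  also have "\<dots> = (\<integral>\<^sup>+l. (if t < l then s else gf_ennreal p (trunc_mean p s m (t - l)))
      \<partial>density lborel (exponential_density 1))"
    by (simp only: offspring)
  also have "\<dots> = trunc_mean p s (Suc m) t"
    by (simp add: nn_integral_density)
  finally show ?case .
qed simp

end

section \<open>The integral equation\<close>

lemma gf_ennreal_mono: "y \<le> y' \<Longrightarrow> gf_ennreal v y \<le> gf_ennreal v y'"
  unfolding gf_ennreal_def by (intro suminf_le mult_left_mono power_mono_ennreal) simp_all

lemma power_SUP_ennreal: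
  fixes Y :: "nat \<Rightarrow> ennreal"
  assumes "incseq Y"
  shows "(SUP m. Y m) ^ k = (SUP m. Y m ^ k)"
proof (induction k)
  case (Suc k)
  have "(SUP m. Y m) ^ Suc k = (SUP i. SUP j. Y i * Y j ^ k)"
    by (simp only: power_Suc Suc SUP_mult_right_ennreal SUP_mult_left_ennreal) (rule SUP_commute)
  also have "\<dots> = (SUP m. Y m ^ Suc k)"
  proof (rule antisym)
    show "(SUP i. SUP j. Y i * Y j ^ k) \<le> (SUP m. Y m ^ Suc k)"
    proof (intro SUP_least)
      fix i j
      have "Y i * Y j ^ k \<le> Y (max i j) * Y (max i j) ^ k"
        using assms by (intro mult_mono power_mono_ennreal) (simp_all add: incseq_def)
      also have "\<dots> \<le> (SUP m. Y m ^ Suc k)"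
        by (rule SUP_upper2[of "max i j"]) simp_all
      finally show "Y i * Y j ^ k \<le> (SUP m. Y m ^ Suc k)" .
    qed
    show "(SUP m. Y m ^ Suc k) \<le> (SUP i. SUP j. Y i * Y j ^ k)"
    proof (rule SUP_least)
      fix m
      have "Y m ^ Suc k \<le> (SUP j. Y m * Y j ^ k)"
        by (rule SUP_upper2[of m]) simp_all
      also have "\<dots> \<le> (SUP i. SUP j. Y i * Y j ^ k)"
        by (rule SUP_upper) simp
      finally show "Y m ^ Suc k \<le> (SUP i. SUP j. Y i * Y j ^ k)" .
    qed
  qed
  finally show ?case .
qed simp

lemma gf_ennreal_SUP:
  assumes "incseq Y"
  shows "gf_ennreal v (SUP m. Y m) = (SUP m. gf_ennreal v (Y m))"
proof -
  have "gf_ennreal v (SUP m. Y m) = (\<Sum>k. SUP m. ennreal (v k) * Y m ^ k)"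
    by (simp only: gf_ennreal_def power_SUP_ennreal[OF assms] SUP_mult_left_ennreal)
  also have "\<dots> = (SUP m. \<Sum>k. ennreal (v k) * Y m ^ k)"
  proof (rule ennreal_suminf_SUP_eq)
    fix k show "incseq (\<lambda>m. ennreal (v k) * Y m ^ k)"
      using assms by (intro incseq_SucI mult_left_mono power_mono_ennreal) (simp_all add: incseq_SucD)
  qed
  finally show ?thesis by (simp only: gf_ennreal_def)
qed

lemma gf_ennreal_eq:
  assumes "\<And>k. 0 \<le> v k" "0 \<le> x" "summable (\<lambda>k. v k * x ^ k)"
  shows "gf_ennreal v (ennreal x) = ennreal (gf v x)"
proof -
  have "gf_ennreal v (ennreal x) = (\<Sum>k. ennreal (v k * x ^ k))"
    using assms by (simp add: gf_ennreal_def ennreal_power ennreal_mult)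
  also have "\<dots> = ennreal (gf v x)"
    unfolding gf_def using assms by (intro suminf_ennreal2) simp_all
  finally show ?thesis .
qed

lemma nn_integral_exponential_density:
  "(\<integral>\<^sup>+l. ennreal (exponential_density 1 l) * c \<partial>lborel) = c"
proof -
  interpret prob_space "density lborel (exponential_density 1)"
    by (rule prob_space_exponential_density) simp
  have "(\<integral>\<^sup>+l. ennreal (exponential_density 1 l) * c \<partial>lborel) =
      (\<integral>\<^sup>+l. c \<partial>density lborel (exponential_density 1))"
    by (subst nn_integral_density) simp_all
  also have "\<dots> = c" using emeasure_space_1 by simp
  finally show ?thesis .
qed

text \<open>The constant \<open>c\<close> is a supersolution of the recursion, as the exponential
  density has mass 1. It is applied to the fixed points \<open>q\<close> and \<open>r\<close>, and
  to 1, where only f(1) <= 1 is known.\<close>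

lemma trunc_mean_le:
  assumes "s \<le> c" "gf_ennreal v c \<le> c"
  shows "trunc_mean v s m t \<le> c"
proof (induction m arbitrary: t)
  case (Suc m)
  have "gf_ennreal v (trunc_mean v s m u) \<le> c" for u
    using gf_ennreal_mono[OF Suc.IH] assms(2) by (rule order_trans)
  then have "trunc_mean v s (Suc m) t \<le> (\<integral>\<^sup>+l. ennreal (exponential_density 1 l) * c \<partial>lborel)"
    using assms(1) unfolding trunc_mean.simps by (intro nn_integral_mono mult_left_mono) simp_all
  then show ?case by (simp only: nn_integral_exponential_density)
qed simp

lemma incseq_trunc_mean: "incseq (\<lambda>m. trunc_mean v s m t)"
proof (rule incseq_SucI)
  fix m show "trunc_mean v s m t \<le> trunc_mean v s (Suc m) t"
  proof (induction m arbitrary: t)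
    case (Suc m)
    have "gf_ennreal v (trunc_mean v s m u) \<le> gf_ennreal v (trunc_mean v s (Suc m) u)" for u
      by (rule gf_ennreal_mono[OF Suc.IH])
    then show ?case
      unfolding trunc_mean.simps(2)[of v s m t] trunc_mean.simps(2)[of v s "Suc m" t]
      by (intro nn_integral_mono mult_left_mono) (simp_all del: trunc_mean.simps)
  qed simp
qed

definition mean_val :: "(nat \<Rightarrow> real) \<Rightarrow> ennreal \<Rightarrow> real \<Rightarrow> ennreal" where
  "mean_val v s t = (SUP m. trunc_mean v s m t)"

lemma borel_measurable_mean_val [measurable]: "mean_val v s \<in> borel_measurable borel"
  unfolding mean_val_def[abs_def] by measurable

lemma mean_val_le: "s \<le> c \<Longrightarrow> gf_ennreal v c \<le> c \<Longrightarrow> mean_val v s t \<le> c"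
  unfolding mean_val_def by (intro SUP_least trunc_mean_le)

lemma mean_val_renewal:
  "mean_val v s t = (\<integral>\<^sup>+l. ennreal (exponential_density 1 l) *
     (if t < l then s else gf_ennreal v (mean_val v s (t - l))) \<partial>lborel)"
proof -
  let ?f = "\<lambda>m l. ennreal (exponential_density 1 l) * (if t < l then s else gf_ennreal v (trunc_mean v s m (t - l)))"
  have "mean_val v s t = (SUP m. trunc_mean v s (Suc m) t)"
    unfolding mean_val_def
  proof (rule antisym)
    show "(SUP m. trunc_mean v s m t) \<le> (SUP m. trunc_mean v s (Suc m) t)"
      by (rule SUP_mono) (metis incseq_SucD incseq_trunc_mean UNIV_I)
    show "(SUP m. trunc_mean v s (Suc m) t) \<le> (SUP m. trunc_mean v s m t)"
      by (rule SUP_mono) blast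
  qed
  also have "\<dots> = (SUP m. integral\<^sup>N lborel (?f m))" by simp
  also have "\<dots> = (\<integral>\<^sup>+l. (SUP m. ?f m l) \<partial>lborel)"
  proof (rule nn_integral_monotone_convergence_SUP[symmetric])
    show "incseq ?f"
      using incseq_SucD[OF incseq_trunc_mean]
      by (intro incseq_SucI le_funI mult_left_mono) (simp_all add: gf_ennreal_mono del: trunc_mean.simps)
  qed measurable
  also have "\<dots> = (\<integral>\<^sup>+l. ennreal (exponential_density 1 l) *
     (if t < l then s else gf_ennreal v (mean_val v s (t - l))) \<partial>lborel)"
    by (intro nn_integral_cong)
      (simp add: SUP_mult_left_ennreal[symmetric] mean_val_def gf_ennreal_SUP[OF incseq_trunc_mean])
  finally show ?thesis .
qed

lemma mean_val_integral_eq: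
  assumes "0 \<le> t"
  shows "mean_val v s t = ennreal (exp (- t)) * s +
    (\<integral>\<^sup>+u. indicator {0..t} u * ennreal (exp (- (t - u))) * gf_ennreal v (mean_val v s u) \<partial>lborel)"
proof -
  let ?H = "\<lambda>u. gf_ennreal v (mean_val v s u)"
  let ?g = "\<lambda>l. indicator {0..t} l * ennreal (exp (- l)) * ?H (t - l)"
  have "(\<integral>\<^sup>+l. ennreal (exp (- l)) * indicator {t..} l \<partial>lborel) = ennreal (0 - (- exp (- t)))"
  proof (rule nn_integral_FTC_atLeast)
    show "((\<lambda>x::real. - exp (- x)) \<longlongrightarrow> 0) at_top" by real_asymp
  qed (auto intro!: derivative_eq_intros)
  then have tail: "(\<integral>\<^sup>+l. ennreal (exp (- l)) * indicator {t..} l \<partial>lborel) = ennreal (exp (- t))"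
    by simp
  have "mean_val v s t = (\<integral>\<^sup>+l. s * (ennreal (exp (- l)) * indicator {t..} l) + ?g l \<partial>lborel)"
    unfolding mean_val_renewal[of v s t]
  proof (rule nn_integral_cong_AE)
    \<comment> \<open>At \<open>l = t\<close> the indicators of both parts equal 1; this single
      point is discarded.\<close>
    have "AE l in lborel. l \<noteq> t" by (rule AE_lborel_singleton)
    then show "AE l in lborel. ennreal (exponential_density 1 l) *
        (if t < l then s else ?H (t - l)) = s * (ennreal (exp (- l)) * indicator {t..} l) + ?g l"
    proof (rule AE_mp, intro AE_I2 impI)
      fix l :: real assume "l \<noteq> t"
      then consider "l < 0" | "0 \<le> l" "l < t" | "t < l" by linarith
      then show "ennreal (exponential_density 1 l) *
        (if t < l then s else ?H (t - l)) = s * (ennreal (exp (- l)) * indicator {t..} l) + ?g l"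
        using assms by cases (simp_all add: exponential_density_def mult.commute)
    qed
  qed
  also have "\<dots> = s * ennreal (exp (- t)) + integral\<^sup>N lborel ?g"
    by (subst nn_integral_add) (simp_all add: nn_integral_cmult tail)
  \<comment> \<open>The substitution u = t - l, which turns the convolution around.\<close>
  also have "integral\<^sup>N lborel ?g = ennreal \<bar>-1\<bar> * (\<integral>\<^sup>+u. ?g (t + (-1) * u) \<partial>lborel)"
    by (rule nn_integral_real_affine) simp_all
  also have "\<dots> = (\<integral>\<^sup>+u. indicator {0..t} u * ennreal (exp (- (t - u))) * ?H u \<partial>lborel)"
    by (simp, intro nn_integral_cong) (auto simp: indicator_def)
  finally show ?thesis by (simp only: mult.commute)
qed

text \<open>A bootstrap in regularity: \<phi> composed with \<open>G\<close> is at first only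
  measurable and bounded. The integral equation makes \<open>G\<close> continuous, hence the
  integrand continuous, hence \<open>G\<close> differentiable.\<close>

lemma real_integral_eq_imp_ode:
  fixes G \<phi> :: "real \<Rightarrow> real"
  assumes G: "\<And>t. 0 \<le> t \<Longrightarrow> 0 \<le> G t \<and> G t \<le> r" and \<phi>: "continuous_on {0..r} \<phi>"
    and \<phi>_bounds: "\<And>x. 0 \<le> x \<Longrightarrow> x \<le> r \<Longrightarrow> 0 \<le> \<phi> x \<and> \<phi> x \<le> c"
    and meas [measurable]: "(\<lambda>u. indicator {0..} u * \<phi> (G u)) \<in> borel_measurable borel"
    and "0 \<le> s"
    and eq: "\<And>t. 0 \<le> t \<Longrightarrow> ennreal (G t) = ennreal (exp (- t)) * ennreal s +
      (\<integral>\<^sup>+u. indicator {0..t} u * ennreal (exp (- (t - u))) * ennreal (\<phi> (G u)) \<partial>lborel)"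
  shows "G 0 = s" "0 \<le> t \<Longrightarrow> t \<le> T \<Longrightarrow>
    (G has_real_derivative \<phi> (G t) - G t) (at t within {0..T})"
proof -
  let ?h = "\<lambda>u. exp u * \<phi> (G u)"
  have int: "set_integrable lborel {0..t} ?h" for t
    unfolding set_integrable_def
  proof (rule Bochner_Integration.integrable_bound)
    show "integrable lborel (\<lambda>u. indicator {0..t} u *\<^sub>R (exp t * c) :: real)"
      by (rule integrable_real_indicator[THEN integrable_scaleR_left]) (simp_all add: emeasure_lborel_Icc_eq)
    have "(\<lambda>u. indicator {0..t} u *\<^sub>R ?h u) =
        (\<lambda>u. indicator {0..t} u * exp u * (indicator {0..} u * \<phi> (G u)))"
      by (rule ext) (simp add: indicator_def)
    also have "\<dots> \<in> borel_measurable lborel" by measurable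
    finally show "(\<lambda>u. indicator {0..t} u *\<^sub>R ?h u) \<in> borel_measurable lborel" .
    have "exp u * \<phi> (G u) \<le> exp t * c" "0 \<le> \<phi> (G u)" if "0 \<le> u" "u \<le> t" for u
      using that G[of u] \<phi>_bounds[of "G u"] by (auto intro!: mult_mono)
    then show "AE u in lborel. norm (indicator {0..t} u *\<^sub>R ?h u) \<le> norm (indicator {0..t} u *\<^sub>R (exp t * c))"
      by (intro AE_I2) (fastforce simp: indicator_def)
  qed
  have G_eq: "G t = exp (- t) * (s + integral {0..t} ?h)" if t: "0 \<le> t" for t
  proof -
    have nn: "0 \<le> (LINT u:{0..t}|lborel. ?h u)"
      unfolding set_lebesgue_integral_def
      using G \<phi>_bounds by (intro integral_nonneg_AE AE_I2) (simp add: indicator_def)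
    have "(\<integral>\<^sup>+u. indicator {0..t} u * ennreal (exp (- (t - u))) * ennreal (\<phi> (G u)) \<partial>lborel) =
        (\<integral>\<^sup>+u. ennreal (exp (- t)) * ennreal (indicator {0..t} u *\<^sub>R ?h u) \<partial>lborel)"
    proof (rule nn_integral_cong)
      fix u
      show "indicator {0..t} u * ennreal (exp (- (t - u))) * ennreal (\<phi> (G u)) =
          ennreal (exp (- t)) * ennreal (indicator {0..t} u *\<^sub>R ?h u)"
        using G[of u] \<phi>_bounds[of "G u"]
        by (simp add: indicator_def ennreal_mult[symmetric] mult_exp_exp mult.assoc[symmetric])
    qed
    also have "\<dots> = ennreal (exp (- t)) * (\<integral>\<^sup>+u. ennreal (indicator {0..t} u *\<^sub>R ?h u) \<partial>lborel)"
      using int[of t] unfolding set_integrable_def by (intro nn_integral_cmult) simp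
    also have "(\<integral>\<^sup>+u. ennreal (indicator {0..t} u *\<^sub>R ?h u) \<partial>lborel) =
        ennreal (LINT u:{0..t}|lborel. ?h u)"
      unfolding set_lebesgue_integral_def
      using int[of t] G \<phi>_bounds unfolding set_integrable_def
      by (intro nn_integral_eq_integral AE_I2) (simp_all add: indicator_def)
    finally have "ennreal (G t) = ennreal (exp (- t) * s + exp (- t) * (LINT u:{0..t}|lborel. ?h u))"
      using eq[OF t] nn \<open>0 \<le> s\<close> by (simp add: ennreal_mult ennreal_plus)
    then have "G t = exp (- t) * s + exp (- t) * (LINT u:{0..t}|lborel. ?h u)"
      using G[OF t] nn \<open>0 \<le> s\<close> by (subst (asm) ennreal_inj) simp_all
    then show ?thesis
      using set_borel_integral_eq_integral(2)[OF int[of t]] by (simp add: algebra_simps)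
  qed
  show "G 0 = s" using G_eq[of 0] by simp
  assume t: "0 \<le> t" "t \<le> T"
  have integ: "?h integrable_on {0..T}"
    by (rule set_borel_integral_eq_integral(1)[OF int])
  have "continuous_on {0..T} (\<lambda>t. exp (- t) * (s + integral {0..t} ?h))"
    by (intro continuous_intros indefinite_integral_continuous_1 integ)
  then have "continuous_on {0..T} G"
    by (rule continuous_on_eq) (rule G_eq[symmetric], simp)
  moreover have "G ` {0..T} \<subseteq> {0..r}" using G by (simp add: image_subset_iff)
  ultimately have "continuous_on {0..T} (\<lambda>u. \<phi> (G u))" by (rule continuous_on_compose2[OF \<phi>])
  then have "continuous_on {0..T} ?h"
    by (rule continuous_on_mult[OF continuous_on_exp[OF continuous_on_id]])
  then have "((\<lambda>t. integral {0..t} ?h) has_real_derivative ?h t) (at t within {0..T})"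
    using t by (intro integral_has_real_derivative) simp_all
  from DERIV_add[OF DERIV_const this, of s]
  have I: "((\<lambda>t. s + integral {0..t} ?h) has_real_derivative ?h t) (at t within {0..T})" by simp
  have "((\<lambda>t. exp (- t)) has_real_derivative - exp (- t)) (at t within {0..T})"
    by (auto intro!: derivative_eq_intros)
  from DERIV_mult[OF this I]
  have "((\<lambda>t. exp (- t) * (s + integral {0..t} ?h)) has_real_derivative \<phi> (G t) - G t) (at t within {0..T})"
    by (rule DERIV_cong) (simp add: G_eq[OF t(1)] exp_minus field_simps)
  then show "(G has_real_derivative \<phi> (G t) - G t) (at t within {0..T})"
    by (rule has_field_derivative_transform_within[where d=1])
      (simp_all only: t zero_less_one atLeastAtMost_iff simp_thms G_eq[symmetric])
qed

text \<open>A finite value in \<open>ennreal\<close> certifies convergence of the real series. This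
  is how the series of the state probabilities is shown to converge up to \<open>r\<close>, even
  beyond 1.\<close>

lemma gf_ennreal_finite_imp:
  assumes "\<And>k. 0 \<le> v k" "0 \<le> x" "gf_ennreal v (ennreal x) \<le> ennreal c"
  shows "summable (\<lambda>k. v k * x ^ k)" "gf_ennreal v (ennreal x) = ennreal (gf v x)"
proof -
  have eq: "gf_ennreal v (ennreal x) = (\<Sum>k. ennreal (v k * x ^ k))"
    using assms by (simp add: gf_ennreal_def ennreal_power ennreal_mult)
  then have "(\<Sum>k. ennreal (v k * x ^ k)) \<noteq> top"
    using assms(3) neq_top_trans[OF ennreal_neq_top] by metis
  then show "summable (\<lambda>k. v k * x ^ k)"
    using assms by (intro summable_suminf_not_top) simp_all
  then show "gf_ennreal v (ennreal x) = ennreal (gf v x)"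
    using assms by (intro gf_ennreal_eq) simp_all
qed

section \<open>State probabilities and their generating function\<close>

text \<open>Finiteness and cardinality are expressed by quantifiers over lists of labels. There are
  countably many such lists, so measurability of the event follows from that of its atoms.\<close>

lemma Z_eq_Some_iff:
  "Z l n t = Some k \<longleftrightarrow> \<not> terminated l n t \<and>
    (\<exists>xs. \<forall>u. u \<in> born l n t \<longrightarrow> u \<in> set xs) \<and>
    (\<exists>xs. distinct xs \<and> length xs = k \<and> (\<forall>u. u \<in> alive l n t \<longleftrightarrow> u \<in> set xs))"
proof -
  have b: "finite (born l n t) \<longleftrightarrow> (\<exists>xs. \<forall>u. u \<in> born l n t \<longrightarrow> u \<in> set xs)"
  proof
    assume "finite (born l n t)"
    then obtain xs where "set xs = born l n t" using finite_list by blast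
    then show "\<exists>xs. \<forall>u. u \<in> born l n t \<longrightarrow> u \<in> set xs" by blast
  next
    assume "\<exists>xs. \<forall>u. u \<in> born l n t \<longrightarrow> u \<in> set xs"
    then obtain xs where "born l n t \<subseteq> set xs" by blast
    then show "finite (born l n t)" by (rule finite_subset) simp
  qed
  have a: "card (alive l n t) = k \<longleftrightarrow>
      (\<exists>xs. distinct xs \<and> length xs = k \<and> (\<forall>u. u \<in> alive l n t \<longleftrightarrow> u \<in> set xs))"
    if fin: "finite (born l n t)"
  proof
    have "finite (alive l n t)" by (rule finite_subset[OF _ fin]) (simp add: alive_def)
    then obtain xs where xs: "set xs = alive l n t" "distinct xs" using finite_distinct_list by blast
    assume "card (alive l n t) = k"
    then have "length xs = k" using distinct_card[OF xs(2)] xs(1) by simp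
    with xs show "\<exists>xs. distinct xs \<and> length xs = k \<and> (\<forall>u. u \<in> alive l n t \<longleftrightarrow> u \<in> set xs)" by blast
  next
    assume "\<exists>xs. distinct xs \<and> length xs = k \<and> (\<forall>u. u \<in> alive l n t \<longleftrightarrow> u \<in> set xs)"
    then obtain xs where xs: "distinct xs" "length xs = k" "\<forall>u. u \<in> alive l n t \<longleftrightarrow> u \<in> set xs" by blast
    then have "alive l n t = set xs" by blast
    then show "card (alive l n t) = k" using distinct_card[OF xs(1)] xs(2) by simp
  qed
  show ?thesis
  proof (cases "terminated l n t \<or> infinite (born l n t)")
    case True
    then show ?thesis unfolding b[symmetric] by (auto simp: Z_def)
  next
    case False
    then show ?thesis unfolding b[symmetric] using a by (simp add: Z_def)
  qed
qed

context branching_process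
begin

lemma pred_in_tree [measurable]: "Measurable.pred M (\<lambda>\<omega>. in_tree (\<lambda>u. N u \<omega>) u)"
proof -
  have [measurable]: "Measurable.pred M (\<lambda>\<omega>. \<exists>k. N w \<omega> = Some k \<and> c < k)" for w c
  proof -
    have "Measurable.pred (count_space UNIV) (\<lambda>n. \<exists>k. n = Some k \<and> c < k)" by simp
    from measurable_compose[OF measurable_N this] show ?thesis .
  qed
  show ?thesis unfolding in_tree_def by measurable
qed

lemma borel_measurable_birth_time [measurable]:
  "(\<lambda>\<omega>. birth_time (\<lambda>u. L u \<omega>) u) \<in> borel_measurable M"
  unfolding birth_time_def by measurable

lemma pred_born [measurable]: "Measurable.pred M (\<lambda>\<omega>. u \<in> born (\<lambda>u. L u \<omega>) (\<lambda>u. N u \<omega>) t)"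
  unfolding born_def mem_Collect_eq by measurable

lemma pred_alive [measurable]: "Measurable.pred M (\<lambda>\<omega>. u \<in> alive (\<lambda>u. L u \<omega>) (\<lambda>u. N u \<omega>) t)"
  unfolding alive_def mem_Collect_eq by measurable

lemma pred_terminated [measurable]: "Measurable.pred M (\<lambda>\<omega>. terminated (\<lambda>u. L u \<omega>) (\<lambda>u. N u \<omega>) t)"
  unfolding terminated_def Bex_def by measurable

lemma sets_state [measurable]:
  "{\<omega> \<in> space M. Z (\<lambda>u. L u \<omega>) (\<lambda>u. N u \<omega>) t = Some k} \<in> sets M"
  unfolding Z_eq_Some_iff by measurable

text \<open>There are countably many labels, so one null set serves all of them; the pathwise lemmas
  on the tree require nonnegative life lengths everywhere.\<close>

lemma AE_life_nonneg: "AE \<omega> in M. \<forall>u. 0 \<le> L u \<omega>"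
  unfolding AE_all_countable
proof
  fix u
  have "prob {\<omega> \<in> space M. 0 < L u \<omega>} = 1"
    using exponential_distributedD_gt[OF life_length[of u], of 0] by simp
  then have "AE \<omega> in M. 0 < L u \<omega>" by (subst (asm) prob_Collect_eq_1) simp_all
  then show "AE \<omega> in M. 0 \<le> L u \<omega>" by eventually_elim simp
qed

lemma nn_integral_zval:
  "(\<integral>\<^sup>+\<omega>. zval s (\<lambda>u. L u \<omega>) (\<lambda>u. N u \<omega>) t \<partial>M) = gf_ennreal (state_prob M L N t) s"
proof -
  let ?Z = "\<lambda>\<omega>. Z (\<lambda>u. L u \<omega>) (\<lambda>u. N u \<omega>) t"
  let ?A = "\<lambda>k. {\<omega> \<in> space M. ?Z \<omega> = Some k}"
  have decomp: "zval s (\<lambda>u. L u \<omega>) (\<lambda>u. N u \<omega>) t = (\<Sum>k. s ^ k * indicator (?A k) \<omega>)"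
    if "\<omega> \<in> space M" for \<omega>
  proof (cases "?Z \<omega>")
    case (Some j)
    have "(\<Sum>k. s ^ k * indicator (?A k) \<omega>) = (\<Sum>k\<in>{j}. s ^ k * indicator (?A k) \<omega>)"
      by (rule suminf_finite) (simp_all add: Some)
    then show ?thesis using that by (simp add: zval_def Some)
  qed (simp add: zval_def)
  have "(\<integral>\<^sup>+\<omega>. zval s (\<lambda>u. L u \<omega>) (\<lambda>u. N u \<omega>) t \<partial>M) = (\<integral>\<^sup>+\<omega>. (\<Sum>k. s ^ k * indicator (?A k) \<omega>) \<partial>M)"
    by (rule nn_integral_cong) (rule decomp)
  also have "\<dots> = (\<Sum>k. s ^ k * emeasure M (?A k))"
    by (subst nn_integral_suminf) (simp_all add: nn_integral_cmult_indicator sets_state)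
  finally show ?thesis
    by (simp only: gf_ennreal_def state_prob_def emeasure_eq_measure mult.commute)
qed

lemma gf_ennreal_state_prob:
  assumes "0 \<le> t"
  shows "gf_ennreal (state_prob M L N t) s = mean_val p s t"
proof -
  let ?X = "\<lambda>\<omega> u. mark u \<omega>"
  have "(\<lambda>\<omega>. restrict (?X \<omega>) UNIV) \<in> measurable M (PiM UNIV (\<lambda>_. mark_space))"
    by (intro measurable_restrict measurable_mark)
  then have X: "?X \<in> measurable M (PiM UNIV (\<lambda>_. mark_space))"
    by (simp add: restrict_def)
  have "AE \<omega> in M. zval s (\<lambda>u. L u \<omega>) (\<lambda>u. N u \<omega>) t = (SUP m. trunc_val s m t (?X \<omega>))"
    using AE_life_nonneg
  proof eventually_elim
    case (elim \<omega>)
    then show ?case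
      using SUP_trunc_val[of "\<lambda>u. L u \<omega>" t s "\<lambda>u. N u \<omega>"] assms by (simp add: mark_def)
  qed
  then have "(\<integral>\<^sup>+\<omega>. zval s (\<lambda>u. L u \<omega>) (\<lambda>u. N u \<omega>) t \<partial>M) = (\<integral>\<^sup>+\<omega>. (SUP m. trunc_val s m t (?X \<omega>)) \<partial>M)"
    by (rule nn_integral_cong_AE)
  also have "\<dots> = (SUP m. \<integral>\<^sup>+\<omega>. trunc_val s m t (?X \<omega>) \<partial>M)"
  proof (rule nn_integral_monotone_convergence_SUP)
    show "incseq (\<lambda>m \<omega>. trunc_val s m t (?X \<omega>))"
      using trunc_val_mono by (simp add: mono_def le_fun_def)
    show "(\<lambda>\<omega>. trunc_val s m t (?X \<omega>)) \<in> borel_measurable M" for m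
      by (rule measurable_trunc_val_comp[OF _ X]) simp
  qed
  also have "\<dots> = mean_val p s t"
    using nn_integral_trunc_val[where v="[]"] by (simp add: mean_val_def)
  finally show ?thesis by (simp only: nn_integral_zval)
qed

lemma state_prob_nonneg: "0 \<le> state_prob M L N t k"
  by (simp add: state_prob_def)

lemma defective_pgf_state_prob:
  assumes "0 \<le> t"
  shows "defective_pgf (state_prob M L N t)"
proof -
  have "summable (\<lambda>k. p k * 1 ^ k)" "0 \<le> gf p 1" "gf p 1 \<le> 1" "\<And>k. 0 \<le> p k"
    using offspring_pgf by (auto simp: defective_pgf_def gf_def intro: suminf_nonneg)
  then have "gf_ennreal p (ennreal 1) \<le> ennreal 1"
    by (subst gf_ennreal_eq) simp_all
  then have le: "gf_ennreal (state_prob M L N t) (ennreal 1) \<le> ennreal 1"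
    unfolding gf_ennreal_state_prob[OF assms] by (intro mean_val_le) simp_all
  note * = gf_ennreal_finite_imp[OF state_prob_nonneg zero_le_one le]
  have "gf (state_prob M L N t) 1 \<le> 1"
    using le unfolding *(2) by (simp add: ennreal_le_1)
  with *(1) show ?thesis
    by (simp add: defective_pgf_def gf_def state_prob_nonneg)
qed

context
  fixes q r :: real
  assumes extendable: "extendable q r p"
begin

lemma p_nonneg: "0 \<le> p k"
  using offspring_pgf by (simp add: defective_pgf_def)

lemma p_summable: "summable (\<lambda>k. p k * r ^ k)" and gf_q: "gf p q = q" and gf_r: "gf p r = r"
  using extendable by (auto simp: extendable_def gf_def sums_iff)

text \<open>Used with \<open>c = r\<close> for convergence and range on [0, r], and with
  \<open>c = q\<close> for the bound by \<open>q\<close> on [0, q].\<close>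

lemma state_gf_le:
  assumes "0 \<le> t" "0 \<le> s" "s \<le> c" "0 \<le> c" "c \<le> r" "gf p c = c"
  shows "summable (\<lambda>k. state_prob M L N t k * s ^ k)" "0 \<le> gf (state_prob M L N t) s"
    "gf (state_prob M L N t) s \<le> c" "mean_val p (ennreal s) t = ennreal (gf (state_prob M L N t) s)"
proof -
  have "gf_ennreal p (ennreal c) = ennreal c"
    using assms gf_ennreal_eq[OF p_nonneg assms(4) gf_summable[OF p_nonneg p_summable assms(4,5)]] by simp
  then have "mean_val p (ennreal s) t \<le> ennreal c"
    using assms by (intro mean_val_le) (simp_all add: ennreal_leI)
  then have le: "gf_ennreal (state_prob M L N t) (ennreal s) \<le> ennreal c"
    by (simp only: gf_ennreal_state_prob[OF assms(1)])
  note * = gf_ennreal_finite_imp[OF state_prob_nonneg assms(2) le]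
  show "summable (\<lambda>k. state_prob M L N t k * s ^ k)" by (fact *(1))
  show "0 \<le> gf (state_prob M L N t) s"
    by (rule gf_nonneg[OF state_prob_nonneg *(1) assms(2)])
  show "gf (state_prob M L N t) s \<le> c"
    using le assms(4) unfolding *(2) by (simp add: ennreal_le_iff)
  show "mean_val p (ennreal s) t = ennreal (gf (state_prob M L N t) s)"
    using *(2) by (simp only: gf_ennreal_state_prob[OF assms(1)])
qed

lemma state_gf_ode:
  assumes s: "0 \<le> s" "s \<le> r"
  shows "gf (state_prob M L N 0) s = s"
    "0 \<le> t \<Longrightarrow> t \<le> T \<Longrightarrow> ((\<lambda>t. gf (state_prob M L N t) s) has_real_derivative
      gf p (gf (state_prob M L N t) s) - gf (state_prob M L N t) s) (at t within {0..T})"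
proof -
  let ?G = "\<lambda>t. gf (state_prob M L N t) s"
  have r: "0 \<le> r" using s by simp
  have G: "0 \<le> ?G t \<and> ?G t \<le> r" if "0 \<le> t" for t
    using state_gf_le(2,3)[OF that s r order_refl gf_r] by simp
  have mv: "mean_val p (ennreal s) t = ennreal (?G t)" if "0 \<le> t" for t
    by (rule state_gf_le(4)[OF that s r order_refl gf_r])
  have sm: "summable (\<lambda>k. p k * x ^ k)" if "0 \<le> x" "x \<le> r" for x
    by (rule gf_summable[OF p_nonneg p_summable that])
  have bounds: "0 \<le> gf p x \<and> gf p x \<le> r" if "0 \<le> x" "x \<le> r" for x
    using gf_nonneg[OF p_nonneg sm[OF that] that(1)] gf_mono[OF p_nonneg p_summable that] gf_r by simp
  have gf_ennreal: "gf_ennreal p (mean_val p (ennreal s) t) = ennreal (gf p (?G t))" if "0 \<le> t" for t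
    unfolding mv[OF that] using G[OF that] by (intro gf_ennreal_eq p_nonneg sm) simp_all
  \<comment> \<open>Measurability in time is inherited from \<open>mean_val\<close>, which is known
    to agree with \<open>?G\<close> only at nonnegative times; hence the indicator.\<close>
  have "(\<lambda>u. indicator {0..} u * enn2real (gf_ennreal p (mean_val p (ennreal s) u))) \<in> borel_measurable borel"
    by measurable
  also have "(\<lambda>u. indicator {0..} u * enn2real (gf_ennreal p (mean_val p (ennreal s) u))) =
      (\<lambda>u. indicator {0..} u * gf p (?G u))"
    by (rule ext) (use gf_ennreal bounds G in \<open>simp add: indicator_def\<close>)
  finally have meas: "(\<lambda>u. indicator {0..} u * gf p (?G u)) \<in> borel_measurable borel" .
  have eq: "ennreal (?G t) = ennreal (exp (- t)) * ennreal s +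
      (\<integral>\<^sup>+u. indicator {0..t} u * ennreal (exp (- (t - u))) * ennreal (gf p (?G u)) \<partial>lborel)"
    if "0 \<le> t" for t
  proof -
    have "(\<integral>\<^sup>+u. indicator {0..t} u * ennreal (exp (- (t - u))) * gf_ennreal p (mean_val p (ennreal s) u) \<partial>lborel) =
        (\<integral>\<^sup>+u. indicator {0..t} u * ennreal (exp (- (t - u))) * ennreal (gf p (?G u)) \<partial>lborel)"
      by (rule nn_integral_cong) (use gf_ennreal in \<open>simp add: indicator_def\<close>)
    then show ?thesis using mean_val_integral_eq[OF that, of p "ennreal s"] mv[OF that] by simp
  qed
  note * = real_integral_eq_imp_ode[where G="?G" and \<phi>="gf p",
      OF G continuous_on_gf[OF p_nonneg p_summable] bounds meas s(1) eq]
  show "?G 0 = s" by (rule *(1))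
  show "0 \<le> t \<Longrightarrow> t \<le> T \<Longrightarrow> (?G has_real_derivative gf p (?G t) - ?G t) (at t within {0..T})"
    by (rule *(2))
qed

end

end

text \<open>Derivatives are taken within [0, r] because the series may diverge beyond
  \<open>r\<close>; finiteness of f'(r) is expressed as differentiability there. That
  \<open>r\<close> stays fixed is claimed under this condition or Osgood's.\<close>

theorem theorem3:
  fixes M :: "'w measure"
    and p :: "nat \<Rightarrow> real"
    and L :: "nat list \<Rightarrow> 'w \<Rightarrow> real"
    and N :: "nat list \<Rightarrow> 'w \<Rightarrow> nat option"
    and q r :: real
    and f :: "real \<Rightarrow> real"
    and F :: "real \<Rightarrow> real \<Rightarrow> real"
    and \<alpha> \<beta> \<gamma> :: real
  assumes "branching_process M p L N"
    and "extendable q r p"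
  defines "f \<equiv> gf p"
    and "F \<equiv> \<lambda>t. gf (state_prob M L N t)"
    and "\<alpha> \<equiv> 1 - vector_derivative f (at q within {0..r})"
    and "\<beta> \<equiv> vector_derivative f (at r within {0..r}) - 1"
    and "\<gamma> \<equiv> \<alpha> / \<beta>"
  shows "(\<forall>t>0. defective_pgf (state_prob M L N t) \<and> F t q = q \<and>
            (f differentiable (at r within {0..r}) \<or> osgood q r p \<longrightarrow>
               extendable q r (state_prob M L N t))) \<and>
         (f differentiable (at r within {0..r}) \<longrightarrow>
            0 < \<gamma> \<and> \<gamma> \<le> 1 \<and>
            (\<forall>t>0.
               (F t has_real_derivative exp (- \<alpha> * t)) (at q within {0..r}) \<and>
               (F t has_real_derivative exp (\<beta> * t)) (at r within {0..r}) \<and>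
               (\<forall>s \<in> {0..<q} \<union> {q<..<r}.
                  interval_lebesgue_integrable lborel (ereal s) (ereal (F t s)) (psi p q r \<gamma>) \<and>
                  (F t s - q) / (s - q) =
                    exp (- \<alpha> * t) * ((r - F t s) / (r - s)) powr \<gamma> *
                    exp (LBINT x=ereal s..ereal (F t s). psi p q r \<gamma> x))))"
proof -
  interpret B: branching_process M p L N by fact
  let ?v = "state_prob M L N"
  have F: "F t = gf (?v t)" for t by (simp add: F_def)
  have gf_q: "gf p q = q" and gf_r: "gf p r = r" and q: "0 \<le> q" "q \<le> r" and r: "0 \<le> r"
    using assms(2) by (auto simp: extendable_def gf_def sums_iff)
  note range = B.state_gf_le[OF assms(2) _ _ _ r order_refl gf_r, folded F]
    and at_q = B.state_gf_le(3)[OF assms(2) _ _ _ q gf_q, folded F]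
    and ode = B.state_gf_ode[OF assms(2), folded F]
  interpret G: gf_flow q r p F
  proof (intro gf_flow.intro extendable_gf.intro gf_flow_axioms.intro)
    show "0 \<le> F t s \<and> F t s \<le> r" if "0 \<le> s" "s \<le> r" "0 \<le> t" for s t
      using range(2,3)[OF that(3,1,2)] by blast
    show "F t s \<le> F t s'" if "0 \<le> s" "s \<le> s'" "s' \<le> r" "0 \<le> t" for s s' t
      unfolding F using that by (intro gf_mono[OF B.state_prob_nonneg] range(1)) simp_all
  qed (rule assms(2) B.p1 ode at_q; assumption)+
  have sums: "(\<lambda>k. ?v t k * x ^ k) sums F t x" if "0 \<le> t" "0 \<le> x" "x \<le> r" for t x
    unfolding F gf_def using that by (intro summable_sums range(1)) simp_all
  have ext: "extendable q r (?v t)" if "0 < t" "F t r = r" for t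
    using assms(2) sums[of t q] sums[of t r] that G.flow_q[of t] G.q_nonneg G.q_less_r
      B.defective_pgf_state_prob[of t] by (simp add: extendable_def)
  have vd: "vector_derivative f (at x within {0..r}) = D"
    if "(f has_real_derivative D) (at x within {0..r})" "0 \<le> x" "x \<le> r" for x D
    using that G.r_pos vector_derivative_within_cbox[of 0 r x f D]
    by (simp add: has_real_derivative_iff_has_vector_derivative)
  have \<alpha>: "\<alpha> = 1 - G.deriv_q"
    unfolding \<alpha>_def using G.q_nonneg G.q_less_r
    by (subst vd[of G.deriv_q]) (simp_all add: f_def G.deriv_q(2))
  have diff: "extendable q r (?v t) \<and> 0 < \<gamma> \<and> \<gamma> \<le> 1 \<and>
      (F t has_real_derivative exp (- \<alpha> * t)) (at q within {0..r}) \<and>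
      (F t has_real_derivative exp (\<beta> * t)) (at r within {0..r}) \<and>
      (\<forall>s \<in> {0..<q} \<union> {q<..<r}.
        interval_lebesgue_integrable lborel (ereal s) (ereal (F t s)) (psi p q r \<gamma>) \<and>
        (F t s - q) / (s - q) =
          exp (- \<alpha> * t) * ((r - F t s) / (r - s)) powr \<gamma> *
          exp (LBINT x=ereal s..ereal (F t s). psi p q r \<gamma> x))"
    if d: "f differentiable (at r within {0..r})" and t: "0 < t" for t
  proof -
    define D where "D = vector_derivative f (at r within {0..r})"
    have D: "(gf p has_real_derivative D) (at r within {0..r})"
      using d vector_derivative_works unfolding D_def f_def has_real_derivative_iff_has_vector_derivative by blast
    interpret G: gf_flow_diff q r p F D
      by unfold_locales (rule D)
    have \<beta>: "\<beta> = D - 1" by (simp add: \<beta>_def D_def)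
    have \<gamma>: "\<gamma> = G.gam" by (simp add: \<gamma>_def \<alpha> \<beta> G.gam_def)
    have "- \<alpha> = G.deriv_q - 1" by (simp add: \<alpha>)
    then show ?thesis
      using G.gam_bounds G.flow_deriv_q[of t] G.flow_deriv_r[of t] ext[OF t G.flow_r] t
        G.flow_formula[of _ t] G.q_nonneg G.q_less_r
      unfolding \<beta> \<gamma> by (auto simp: \<alpha>)
  qed
  \<comment> \<open>The bounds on \<gamma> do not depend on \<open>t\<close>; they are read off at
    time 1.\<close>
  show ?thesis
    using diff[of 1] diff B.defective_pgf_state_prob G.flow_q ext G.osgood_imp_flow_r
    by (meson less_imp_le zero_less_one)
qed

end
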